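(* Let $G$ be a discrete group and let $A$ be a non-empty subset of $G$. Then the following are equivalent: (i) Some minimal closed $G$-invariant subset of $X_A$ is discrete. (ii) The $C^*$-algebra $1_A\big(\ell^\infty(G)\rtimes_{\mathrm{red}}G\big)1_A$ has a non-zero finite-dimensional quotient. (iii) $A$ is not infinitely divisible.
   Context: $\beta G$ is the Stone–Čech compactification of the discrete space $G$, with the $G$-action extending left multiplication. For $B\subseteq G$, $K_B$ is the closure of $B$ in $\beta G$, and $X_A=\bigcup_{g\in G}K_{gA}$, an open $G$-invariant subset of $\beta G$ with the subspace topology. A minimal closed $G$-invariant subset of $X_A$ is a non-empty subset, closed in $X_A$ and $G$-invariant, containing no proper non-empty closed $G$-invariant subset; it is discrete if its subspace topology is discrete. $\ell^\infty(G)\rtimes_{\mathrm{red}}G$ is the reduced crossed product for the left translation action $(g\cdot f)(h)=f(g^{-1}h)$; equivalently the $C^*$-subalgebra of $B(\ell^2(G))$ generated by $\ell^\infty(G)$ (multiplication operators) and the image of the left-regular representation of $G$. $1_A\in\ell^\infty(G)$ is the indicator function of $A$. Quotients are by closed two-sided ideals. For non-empty $B,C\subseteq G$ write $B\propto C$ if $B\subseteq FC=\bigcup_{g\in F}gC$ for some finite $F\subseteq G$, and $B\approx C$ if $B\propto C$ and $C\propto B$. For $n\ge1$, $A$ is $n$-divisible if there are pairwise disjoint subsets $A_1,\dots,A_n$ of $A$ with $A_j\approx A$ for all $j$. $A$ is infinitely divisible if it is $n$-divisible for all integers $n\ge1$. *)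

theory Defs
  imports "HOL-Analysis.Analysis"
begin

text \<open>
  A discrete group is a type of class \<^class>\<open>group_add\<close>, the (not necessarily commutative) groups
  of the library. The group operation is therefore written \<open>g + h\<close>, the inverse \<open>- g\<close>.
\<close>

section \<open>The Stone--Cech compactification of a discrete group\<close>

definition ultrafilter :: "'a filter \<Rightarrow> bool" where
  "ultrafilter U \<longleftrightarrow>
     U \<noteq> bot \<and> (\<forall>P. eventually P U \<or> eventually (\<lambda>x. \<not> P x) U)"

text \<open>
  The Stone--Cech compactification of a discrete set, realised as the space of its ultrafilters:
  \<open>x\<close> is identified with the ultrafilter \<open>principal {x}\<close>, and a map \<open>f\<close> extends as \<open>filtermap f\<close>.
\<close>

definition betaG :: "'a filter topology" where
  "betaG = topology_generated_by
     (range (\<lambda>B. {U. ultrafilter U \<and> eventually (\<lambda>x. x \<in> B) U}))"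

definition beta_act :: "'a::group_add \<Rightarrow> 'a filter \<Rightarrow> 'a filter" where
  "beta_act g U = filtermap (\<lambda>h. g + h) U"

definition translate :: "'a::group_add \<Rightarrow> 'a set \<Rightarrow> 'a set" where
  "translate g B = (\<lambda>h. g + h) ` B"

definition K_set :: "'a set \<Rightarrow> 'a filter set" where
  "K_set B = betaG closure_of ((\<lambda>x. principal {x}) ` B)"

definition X_set :: "'a::group_add set \<Rightarrow> 'a filter set" where
  "X_set A = (\<Union>g. K_set (translate g A))"

definition X_top :: "'a::group_add set \<Rightarrow> 'a filter topology" where
  "X_top A = subtopology betaG (X_set A)"

definition G_invariant :: "'a::group_add filter set \<Rightarrow> bool" where
  "G_invariant M \<longleftrightarrow> (\<forall>g. \<forall>U\<in>M. beta_act g U \<in> M)"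

definition minimal_closed_invariant :: "'a::group_add set \<Rightarrow> 'a filter set \<Rightarrow> bool" where
  "minimal_closed_invariant A M \<longleftrightarrow>
     M \<noteq> {} \<and> closedin (X_top A) M \<and> G_invariant M \<and>
     \<not> (\<exists>N. N \<subset> M \<and> N \<noteq> {} \<and> closedin (X_top A) N \<and> G_invariant N)"

lemma topspace_betaG: "topspace betaG = {U. ultrafilter U}"
  unfolding betaG_def topology_generated_by_topspace by (auto intro!: exI[of _ UNIV])

lemma ultrafilter_principal: "ultrafilter (principal {x})"
  by (auto simp: ultrafilter_def eventually_principal principal_eq_bot_iff)

lemma ultrafilter_beta_act: "ultrafilter U \<Longrightarrow> ultrafilter (beta_act g U)"
  by (auto simp: ultrafilter_def beta_act_def eventually_filtermap filtermap_bot_iff)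

lemma beta_act_principal: "beta_act g (principal {h}) = principal {g + h}"
  by (simp add: beta_act_def)


section \<open>Divisibility\<close>

definition propto :: "'a::group_add set \<Rightarrow> 'a set \<Rightarrow> bool"  (infix "\<propto>" 50) where
  "B \<propto> C \<longleftrightarrow> B \<noteq> {} \<and> C \<noteq> {} \<and> (\<exists>F. finite F \<and> B \<subseteq> (\<Union>g\<in>F. translate g C))"

definition size_equiv :: "'a::group_add set \<Rightarrow> 'a set \<Rightarrow> bool" where
  "size_equiv B C \<longleftrightarrow> B \<propto> C \<and> C \<propto> B"

definition n_divisible :: "nat \<Rightarrow> 'a::group_add set \<Rightarrow> bool" where
  "n_divisible n A \<longleftrightarrow>
     (\<exists>P :: nat \<Rightarrow> 'a set. (\<forall>j\<in>{1..n}. P j \<subseteq> A \<and> size_equiv (P j) A) \<and>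
        disjoint_family_on P {1..n})"

definition infinitely_divisible :: "'a::group_add set \<Rightarrow> bool" where
  "infinitely_divisible A \<longleftrightarrow> (\<forall>n\<ge>1. n_divisible n A)"


section \<open>The Hilbert space of square-summable functions\<close>

typedef 'a ell2 = "{f :: 'a \<Rightarrow> complex. (\<lambda>i. (cmod (f i))\<^sup>2) summable_on UNIV}"
  morphisms ell2_fun Abs_ell2
  by (rule exI[of _ "\<lambda>_. 0"]) simp

setup_lifting type_definition_ell2

lemma ell2_add_closed:
  assumes "(\<lambda>i. (cmod (f i))\<^sup>2) summable_on UNIV" "(\<lambda>i. (cmod (g i))\<^sup>2) summable_on UNIV"
  shows "(\<lambda>i. (cmod (f i + g i))\<^sup>2) summable_on UNIV"
proof (rule summable_on_comparison_test)
  show "(\<lambda>i. 2 * ((cmod (f i))\<^sup>2 + (cmod (g i))\<^sup>2)) summable_on UNIV"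
    by (intro summable_on_cmult_right summable_on_add assms)
  show "(cmod (f i + g i))\<^sup>2 \<le> 2 * ((cmod (f i))\<^sup>2 + (cmod (g i))\<^sup>2)" for i
  proof -
    have "(cmod (f i + g i))\<^sup>2 \<le> (cmod (f i) + cmod (g i))\<^sup>2"
      by (intro power_mono norm_triangle_ineq) auto
    also have "\<dots> \<le> 2 * ((cmod (f i))\<^sup>2 + (cmod (g i))\<^sup>2)"
      using zero_le_power2[of "cmod (f i) - cmod (g i)"]
      by (simp add: power2_eq_square algebra_simps)
    finally show ?thesis .
  qed
qed auto

lemma ell2_mult_closed:
  assumes "(\<lambda>i. (cmod (f i))\<^sup>2) summable_on UNIV" "\<And>i. cmod (u i) \<le> C"
  shows "(\<lambda>i. (cmod (u i * f i))\<^sup>2) summable_on UNIV"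
proof (rule summable_on_comparison_test)
  show "(\<lambda>i. C\<^sup>2 * (cmod (f i))\<^sup>2) summable_on UNIV"
    by (intro summable_on_cmult_right assms)
  show "(cmod (u i * f i))\<^sup>2 \<le> C\<^sup>2 * (cmod (f i))\<^sup>2" for i
    unfolding norm_mult power_mult_distrib
    by (intro mult_right_mono power_mono assms) auto
qed auto

lemma ell2_inner_summable:
  assumes "(\<lambda>i. (cmod (f i))\<^sup>2) summable_on UNIV" "(\<lambda>i. (cmod (g i))\<^sup>2) summable_on UNIV"
  shows "(\<lambda>i. f i * cnj (g i)) summable_on UNIV"
proof (rule abs_summable_summable, rule summable_on_comparison_test)
  show "(\<lambda>i. (cmod (f i))\<^sup>2 + (cmod (g i))\<^sup>2) summable_on UNIV"
    by (intro summable_on_add assms)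
  show "norm (f i * cnj (g i)) \<le> (cmod (f i))\<^sup>2 + (cmod (g i))\<^sup>2" for i
  proof -
    have "2 * (cmod (f i) * cmod (g i)) \<le> (cmod (f i))\<^sup>2 + (cmod (g i))\<^sup>2"
      using zero_le_power2[of "cmod (f i) - cmod (g i)"]
      by (simp add: power2_eq_square algebra_simps)
    moreover have "0 \<le> cmod (f i) * cmod (g i)" by simp
    ultimately have "cmod (f i) * cmod (g i) \<le> (cmod (f i))\<^sup>2 + (cmod (g i))\<^sup>2" by linarith
    then show ?thesis by (simp add: norm_mult)
  qed
qed auto

instantiation ell2 :: (type) real_vector
begin

lift_definition zero_ell2 :: "'a ell2" is "\<lambda>_. 0" by simp
lift_definition uminus_ell2 :: "'a ell2 \<Rightarrow> 'a ell2" is "\<lambda>f i. - f i" by simp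
lift_definition plus_ell2 :: "'a ell2 \<Rightarrow> 'a ell2 \<Rightarrow> 'a ell2" is "\<lambda>f g i. f i + g i"
  by (rule ell2_add_closed)
lift_definition minus_ell2 :: "'a ell2 \<Rightarrow> 'a ell2 \<Rightarrow> 'a ell2" is "\<lambda>f g i. f i - g i"
  subgoal for f g using ell2_add_closed[of f "\<lambda>i. - g i"] by simp
  done
lift_definition scaleR_ell2 :: "real \<Rightarrow> 'a ell2 \<Rightarrow> 'a ell2" is "\<lambda>r f i. complex_of_real r * f i"
  by (rule ell2_mult_closed) auto

instance
  by standard (transfer; auto simp: algebra_simps fun_eq_iff)+

end

lift_definition cinner :: "'a ell2 \<Rightarrow> 'a ell2 \<Rightarrow> complex" is
  "\<lambda>f g. \<Sum>\<^sub>\<infinity>i. f i * cnj (g i)" .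

lift_definition ell2_scaleC :: "complex \<Rightarrow> 'a ell2 \<Rightarrow> 'a ell2" is "\<lambda>c f i. c * f i"
  by (rule ell2_mult_closed) auto

lemma cinner_add_left: "cinner (x + y) z = cinner x z + cinner y z"
  by transfer (simp add: distrib_right infsum_add ell2_inner_summable)

lemma cinner_scaleC_left: "cinner (ell2_scaleC c x) z = c * cinner x z"
  by transfer (simp add: mult.assoc infsum_cmult_right ell2_inner_summable)

lemma cinner_scaleR_left: "cinner (r *\<^sub>R x) z = complex_of_real r * cinner x z"
  by transfer (simp add: mult.assoc infsum_cmult_right ell2_inner_summable)

lemma cinner_commute: "cinner x y = cnj (cinner y x)"
  by transfer (simp flip: infsum_cnj add: mult.commute)

lemma cinner_self: "cinner x x = complex_of_real (\<Sum>\<^sub>\<infinity>i. (cmod (ell2_fun x i))\<^sup>2)"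
proof transfer
  fix f :: "'a \<Rightarrow> complex"
  assume f: "(\<lambda>i. (cmod (f i))\<^sup>2) summable_on UNIV"
  have "((\<lambda>i. complex_of_real ((cmod (f i))\<^sup>2)) has_sum complex_of_real (\<Sum>\<^sub>\<infinity>i. (cmod (f i))\<^sup>2)) UNIV"
    using f by (intro has_sum_of_real) simp
  then show "(\<Sum>\<^sub>\<infinity>i. f i * cnj (f i)) = complex_of_real (\<Sum>\<^sub>\<infinity>i. (cmod (f i))\<^sup>2)"
    by (simp add: infsumI complex_norm_square del: of_real_power)
qed

text \<open>
  The real inner product is the real part of the complex one; both induce the \<open>\<ell>\<^sup>2\<close>-norm.
\<close>

instantiation ell2 :: (type) real_inner
begin

definition inner_ell2 :: "'a ell2 \<Rightarrow> 'a ell2 \<Rightarrow> real" where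
  "inner_ell2 x y = Re (cinner x y)"
definition norm_ell2 :: "'a ell2 \<Rightarrow> real" where
  "norm_ell2 x = sqrt (\<Sum>\<^sub>\<infinity>i. (cmod (ell2_fun x i))\<^sup>2)"
definition dist_ell2 :: "'a ell2 \<Rightarrow> 'a ell2 \<Rightarrow> real" where
  "dist_ell2 x y = norm (x - y)"
definition sgn_ell2 :: "'a ell2 \<Rightarrow> 'a ell2" where
  "sgn_ell2 x = x /\<^sub>R norm x"
definition uniformity_ell2 :: "('a ell2 \<times> 'a ell2) filter" where
  "uniformity_ell2 = (INF e\<in>{0<..}. principal {(x, y). dist x y < e})"
definition open_ell2 :: "'a ell2 set \<Rightarrow> bool" where
  "open_ell2 U \<longleftrightarrow> (\<forall>x\<in>U. eventually (\<lambda>(x', y). x' = x \<longrightarrow> y \<in> U) uniformity)"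

instance
proof
  fix x y z :: "'a ell2" and r :: real
  show "inner x y = inner y x"
    unfolding inner_ell2_def by (subst cinner_commute) simp
  show "inner (x + y) z = inner x z + inner y z"
    by (simp add: inner_ell2_def cinner_add_left)
  show "inner (r *\<^sub>R x) y = r * inner x y"
    by (simp add: inner_ell2_def cinner_scaleR_left)
  show "0 \<le> inner x x"
    by (simp add: inner_ell2_def cinner_self infsum_nonneg)
  show "norm x = sqrt (inner x x)"
    by (simp add: inner_ell2_def cinner_self norm_ell2_def)
  show "(inner x x = 0) = (x = 0)"
  proof
    assume "inner x x = 0"
    then have s: "(\<Sum>\<^sub>\<infinity>i. (cmod (ell2_fun x i))\<^sup>2) = 0"
      by (simp add: inner_ell2_def cinner_self)
    have "(\<lambda>i. (cmod (ell2_fun x i))\<^sup>2) summable_on UNIV"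
      using ell2_fun[of x] by simp
    then have "(cmod (ell2_fun x i))\<^sup>2 = 0" for i
      using nonneg_infsum_le_0D[of "\<lambda>i. (cmod (ell2_fun x i))\<^sup>2" UNIV i] s by simp
    then show "x = 0"
      by (intro ell2_fun_inject[THEN iffD1]) (simp add: zero_ell2.rep_eq fun_eq_iff)
  qed (simp add: inner_ell2_def cinner_self zero_ell2.rep_eq)
qed (simp_all add: dist_ell2_def sgn_ell2_def uniformity_ell2_def open_ell2_def)

end

lemma norm_ell2_scaleC: "norm (ell2_scaleC c x) = cmod c * norm x"
proof -
  have "(\<lambda>i. (cmod (ell2_fun x i))\<^sup>2) summable_on UNIV"
    using ell2_fun[of x] by simp
  then show ?thesis
    by (simp add: norm_ell2_def ell2_scaleC.rep_eq norm_mult power_mult_distrib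
        infsum_cmult_right real_sqrt_mult)
qed


section \<open>Bounded operators and the reduced crossed product\<close>

text \<open>
  \<^typ>\<open>'a ell2 \<Rightarrow>\<^sub>L 'a ell2\<close> consists of the bounded real-linear operators with the operator norm;
  \<open>B(\<ell>\<^sup>2(G))\<close> is the set of the complex-linear ones among them.
\<close>

type_synonym 'a op = "'a ell2 \<Rightarrow>\<^sub>L 'a ell2"

definition B_ell2 :: "'a op set" where
  "B_ell2 = {T. \<forall>c x. blinfun_apply T (ell2_scaleC c x) = ell2_scaleC c (blinfun_apply T x)}"

definition op_scaleC :: "complex \<Rightarrow> 'a op \<Rightarrow> 'a op" where
  "op_scaleC c T = Blinfun (\<lambda>x. ell2_scaleC c (blinfun_apply T x))"

lemma bounded_linear_ell2_scaleC: "bounded_linear (ell2_scaleC c :: 'a ell2 \<Rightarrow> 'a ell2)"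
proof (rule bounded_linear_intro[where K = "cmod c"])
  fix x y :: "'a ell2" and r :: real
  show "ell2_scaleC c (x + y) = ell2_scaleC c x + ell2_scaleC c y"
    by transfer (simp add: distrib_left)
  show "ell2_scaleC c (r *\<^sub>R x) = r *\<^sub>R ell2_scaleC c x"
    by transfer (simp add: mult.left_commute)
  show "norm (ell2_scaleC c x) \<le> norm x * cmod c"
    by (simp add: norm_ell2_scaleC)
qed

lemma op_scaleC_apply: "blinfun_apply (op_scaleC c T) x = ell2_scaleC c (blinfun_apply T x)"
  unfolding op_scaleC_def
  by (subst bounded_linear_Blinfun_apply)
    (auto intro: bounded_linear_compose[OF bounded_linear_ell2_scaleC] blinfun.bounded_linear_right)

lemma vector_space_op_scaleC: "vector_space op_scaleC"
proof
  fix a b :: complex and S T :: "'a op"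
  show "op_scaleC a (S + T) = op_scaleC a S + op_scaleC a T"
    by (rule blinfun_eqI, simp add: op_scaleC_apply plus_blinfun.rep_eq, transfer)
      (simp add: distrib_left)
  show "op_scaleC (a + b) T = op_scaleC a T + op_scaleC b T"
    by (rule blinfun_eqI, simp add: op_scaleC_apply plus_blinfun.rep_eq, transfer)
      (simp add: distrib_right)
  show "op_scaleC a (op_scaleC b T) = op_scaleC (a * b) T"
    by (rule blinfun_eqI, simp add: op_scaleC_apply, transfer) (simp add: mult.assoc)
  show "op_scaleC 1 T = T"
    by (rule blinfun_eqI, simp add: op_scaleC_apply, transfer) simp
qed

definition is_adjoint :: "'a op \<Rightarrow> 'a op \<Rightarrow> bool" where
  "is_adjoint T S \<longleftrightarrow>
     (\<forall>x y. cinner (blinfun_apply T x) y = cinner x (blinfun_apply S y))"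

definition cstar_subalgebra :: "'a op set \<Rightarrow> bool" where
  "cstar_subalgebra N \<longleftrightarrow>
     N \<subseteq> B_ell2 \<and> closed N \<and> 0 \<in> N \<and>
     (\<forall>S\<in>N. \<forall>T\<in>N. S + T \<in> N) \<and>
     (\<forall>c. \<forall>T\<in>N. op_scaleC c T \<in> N) \<and>
     (\<forall>S\<in>N. \<forall>T\<in>N. S o\<^sub>L T \<in> N) \<and>
     (\<forall>T\<in>N. \<exists>S\<in>N. is_adjoint T S)"

text \<open>
  \<open>Blinfun\<close> and \<open>Abs_ell2\<close> are meaningful only on bounded linear maps and square-summable functions;
  \<open>mult_op_apply\<close> (for bounded \<open>f\<close>) and \<open>lreg_apply\<close> show that this is the case here.
\<close>

definition mult_op :: "('a \<Rightarrow> complex) \<Rightarrow> 'a op" where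
  "mult_op f = Blinfun (\<lambda>x. Abs_ell2 (\<lambda>h. f h * ell2_fun x h))"

definition lreg :: "'a::group_add \<Rightarrow> 'a op" where
  "lreg g = Blinfun (\<lambda>x. Abs_ell2 (\<lambda>h. ell2_fun x (- g + h)))"

lemma mult_op_apply:
  assumes "bounded (range f)"
  shows "ell2_fun (blinfun_apply (mult_op f) x) h = f h * ell2_fun x h"
proof -
  from assms obtain C where C: "\<And>i. cmod (f i) \<le> C"
    by (auto simp: bounded_iff)
  have C0: "0 \<le> C" using C[of undefined] norm_ge_zero order_trans by blast
  define M where "M x = Abs_ell2 (\<lambda>h. f h * ell2_fun x h)" for x
  have sm: "(\<lambda>i. (cmod (ell2_fun x i))\<^sup>2) summable_on UNIV" for x :: "'a ell2"
    using ell2_fun[of x] by simp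
  have M: "ell2_fun (M x) = (\<lambda>h. f h * ell2_fun x h)" for x
    unfolding M_def using ell2_mult_closed[OF sm C] by (subst Abs_ell2_inverse) auto
  have "bounded_linear M"
  proof (rule bounded_linear_intro[where K = C])
    fix x y :: "'a ell2" and r :: real
    show "M (x + y) = M x + M y"
      by (intro ell2_fun_inject[THEN iffD1]) (simp add: M plus_ell2.rep_eq distrib_left)
    show "M (r *\<^sub>R x) = r *\<^sub>R M x"
      by (intro ell2_fun_inject[THEN iffD1]) (simp add: M scaleR_ell2.rep_eq mult.left_commute)
    have "(\<Sum>\<^sub>\<infinity>i. (cmod (ell2_fun (M x) i))\<^sup>2) \<le> (\<Sum>\<^sub>\<infinity>i. C\<^sup>2 * (cmod (ell2_fun x i))\<^sup>2)"
    proof (rule infsum_mono)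
      show "(cmod (ell2_fun (M x) i))\<^sup>2 \<le> C\<^sup>2 * (cmod (ell2_fun x i))\<^sup>2" for i
        unfolding M norm_mult power_mult_distrib
        by (intro mult_right_mono power_mono C) auto
    qed (use sm in \<open>auto intro: summable_on_cmult_right\<close>)
    also have "\<dots> = C\<^sup>2 * (\<Sum>\<^sub>\<infinity>i. (cmod (ell2_fun x i))\<^sup>2)"
      by (rule infsum_cmult_right) (rule sm)
    finally have "norm (M x) \<le> sqrt (C\<^sup>2 * (\<Sum>\<^sub>\<infinity>i. (cmod (ell2_fun x i))\<^sup>2))"
      unfolding norm_ell2_def by (rule real_sqrt_le_mono)
    then show "norm (M x) \<le> norm x * C"
      using C0 by (simp add: norm_ell2_def real_sqrt_mult mult.commute)
  qed
  then show ?thesis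
    using M by (simp add: mult_op_def bounded_linear_Blinfun_apply flip: M_def)
qed

lemma lreg_apply: "ell2_fun (blinfun_apply (lreg g) x) h = ell2_fun x (- g + h)"
proof -
  define L where "L x = Abs_ell2 (\<lambda>h. ell2_fun x (- g + h))" for x
  have bij: "bij_betw (\<lambda>h. - g + h) UNIV UNIV"
    by (rule bij_betw_byWitness[where f' = "\<lambda>h. g + h"]) (auto simp flip: add.assoc)
  have sm: "(\<lambda>i. (cmod (ell2_fun x i))\<^sup>2) summable_on UNIV" for x :: "'a ell2"
    using ell2_fun[of x] by simp
  have L: "ell2_fun (L x) = (\<lambda>h. ell2_fun x (- g + h))" for x
    unfolding L_def
    using summable_on_reindex_bij_betw[OF bij, of "\<lambda>i. (cmod (ell2_fun x i))\<^sup>2"] sm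
    by (subst Abs_ell2_inverse) auto
  have "bounded_linear L"
  proof (rule bounded_linear_intro[where K = 1])
    fix x y :: "'a ell2" and r :: real
    show "L (x + y) = L x + L y"
      by (intro ell2_fun_inject[THEN iffD1]) (simp add: L plus_ell2.rep_eq)
    show "L (r *\<^sub>R x) = r *\<^sub>R L x"
      by (intro ell2_fun_inject[THEN iffD1]) (simp add: L scaleR_ell2.rep_eq)
    show "norm (L x) \<le> norm x * 1"
      using infsum_reindex_bij_betw[OF bij, of "\<lambda>i. (cmod (ell2_fun x i))\<^sup>2"]
      by (simp add: norm_ell2_def L)
  qed
  then show ?thesis
    using L by (simp add: lreg_def bounded_linear_Blinfun_apply flip: L_def)
qed

definition reduced_crossed_product :: "'a::group_add op set" where
  "reduced_crossed_product =
     \<Inter>{N. cstar_subalgebra N \<and> mult_op ` {f. bounded (range f)} \<subseteq> N \<and> range lreg \<subseteq> N}"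

definition corner :: "'a set \<Rightarrow> 'a::group_add op set" where
  "corner A =
     (\<lambda>T. mult_op (indicator A) o\<^sub>L T o\<^sub>L mult_op (indicator A)) ` reduced_crossed_product"


section \<open>Quotients\<close>

definition closed_ideal :: "'a op set \<Rightarrow> 'a op set \<Rightarrow> bool" where
  "closed_ideal C I \<longleftrightarrow>
     I \<subseteq> C \<and> closedin (top_of_set C) I \<and> 0 \<in> I \<and>
     (\<forall>S\<in>I. \<forall>T\<in>I. S + T \<in> I) \<and>
     (\<forall>c. \<forall>T\<in>I. op_scaleC c T \<in> I) \<and>
     (\<forall>S\<in>C. \<forall>T\<in>I. S o\<^sub>L T \<in> I \<and> T o\<^sub>L S \<in> I)"

definition coset :: "'a op set \<Rightarrow> 'a op \<Rightarrow> 'a op set" where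
  "coset I T = (\<lambda>S. T + S) ` I"

definition quotient :: "'a op set \<Rightarrow> 'a op set \<Rightarrow> 'a op set set" where
  "quotient C I = coset I ` C"

text \<open>
  \<open>quotient C I\<close> is finite-dimensional iff the classes of finitely many elements of \<open>C\<close> span it
  over the complex numbers, and it is non-zero iff it contains a class other than \<open>I\<close>.
\<close>

definition has_nonzero_findim_quotient :: "'a op set \<Rightarrow> bool" where
  "has_nonzero_findim_quotient C \<longleftrightarrow>
     (\<exists>I. closed_ideal C I \<and> quotient C I \<noteq> {I} \<and>
        (\<exists>B. finite B \<and> B \<subseteq> C \<and> quotient C I = coset I ` module.span op_scaleC B))"

end

theory Submission
  imports Defs
begin

text \<open>
  All three conditions say that some ultrafilter \<open>U\<close> containing \<open>A\<close> has only finitely many translates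
  containing \<open>A\<close>. For discrete minimal sets this is compactness of \<open>K_set A\<close>. For divisibility, \<open>A\<close> is
  \<open>n\<close>-divisible iff it is a finite union of sets having \<open>n\<close> disjoint translates inside \<open>A\<close>, so that
  otherwise some ultrafilter containing \<open>A\<close> avoids all sets of the latter kind; since the action on
  ultrafilters is free, it then has fewer than \<open>n\<close> translates containing \<open>A\<close>. Given such a \<open>U\<close>, the
  representation of the crossed product on the orbit of \<open>U\<close> maps the corner to matrices of finite
  size. Conversely, in a quotient of dimension \<open>d\<close>, a set with \<open>d + 1\<close> disjoint translates inside
  \<open>A\<close> gives \<open>d + 1\<close> equivalent orthogonal projections, which must vanish; so if \<open>A\<close> is
  \<open>(d + 1)\<close>-divisible, then \<open>1\<^sub>A\<close> vanishes in the quotient.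
\<close>

section \<open>Divisibility and translates\<close>

text \<open>The crossed product is only given as the smallest closed algebra containing the
  generators, so its elements have no explicit form and a representation cannot simply be prescribed
  on generators. It is replaced by limits of matrix entries along \<open>U\<close>. A matrix product
  is an infinite sum, with which such limits need not commute; multiplicativity is saved by the fact
  that columns are, up to a small error, supported in \<open>F + y\<close> with \<open>F\<close>
  finite and independent of \<open>y\<close>. This is why an algebra of operators with that property
  is needed, and why adjoints have to be controlled as well. Only the kernel of the representation
  is ever built: it is the ideal, and finitely many limit entries detect it. The pieces in a
  division are merely equivalent to \<open>A\<close>, which says little about an ultrafilter.
  Replacing them by exact translates of smaller sets turns non-divisibility into an ideal of sets
  that misses \<open>A\<close>. One half of this replacement is a common refinement of
  \<open>n\<close> finite covers, the other a greedy construction.\<close>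

lemma minus_add_add: "- (g + h) + x = - h + (- g + x)" for g :: "'a::group_add"
  by (simp add: minus_add add.assoc del: add_uminus_conv_diff)

lemma mem_translate: "x \<in> translate g B \<longleftrightarrow> - g + x \<in> B"
  unfolding translate_def by (force simp flip: add.assoc)

lemma translate_translate: "translate g (translate h B) = translate (g + h) B"
  by (auto simp: mem_translate minus_add_add)

lemma translate_0 [simp]: "translate 0 B = B"
  by (auto simp: mem_translate)

text \<open>This is \<open>D \<propto> E\<close> without the non-emptiness conditions, because empty
  pieces occur in the induction of \<open>spread_family\<close>.\<close>

definition covers :: "'a::group_add set \<Rightarrow> 'a set \<Rightarrow> bool" where
  "covers E D \<longleftrightarrow> (\<exists>F. finite F \<and> D \<subseteq> (\<Union>g\<in>F. translate g E))"

lemma covers_translate: "covers E (translate g E)"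
  unfolding covers_def by (rule exI[of _ "{g}"]) auto

lemma covers_subset: "D \<subseteq> E \<Longrightarrow> covers E D"
  unfolding covers_def by (rule exI[of _ "{0}"]) auto

lemma covers_trans:
  assumes "covers E D" "covers D C"
  shows "covers E C"
proof -
  obtain F1 F2 where F: "finite F1" "D \<subseteq> (\<Union>g\<in>F1. translate g E)"
      "finite F2" "C \<subseteq> (\<Union>g\<in>F2. translate g D)"
    using assms unfolding covers_def by blast
  have "C \<subseteq> (\<Union>g\<in>(\<lambda>(g, h). g + h) ` (F2 \<times> F1). translate g E)"
  proof
    fix x assume "x \<in> C"
    then obtain g where g: "g \<in> F2" "- g + x \<in> D" using F by (auto simp: mem_translate)
    then obtain h where h: "h \<in> F1" "- h + (- g + x) \<in> E" using F by (auto simp: mem_translate)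
    then have "x \<in> translate (g + h) E" by (simp add: mem_translate minus_add_add)
    then show "x \<in> (\<Union>g\<in>(\<lambda>(g, h). g + h) ` (F2 \<times> F1). translate g E)"
      using g h by force
  qed
  then show ?thesis
    unfolding covers_def using F by (intro exI[of _ "(\<lambda>(g, h). g + h) ` (F2 \<times> F1)"]) auto
qed

lemma covers_Un:
  assumes "covers E C" "covers E D"
  shows "covers E (C \<union> D)"
proof -
  obtain F1 F2 where "finite F1" "C \<subseteq> (\<Union>g\<in>F1. translate g E)"
      "finite F2" "D \<subseteq> (\<Union>g\<in>F2. translate g E)"
    using assms unfolding covers_def by blast
  then show ?thesis
    unfolding covers_def by (intro exI[of _ "F1 \<union> F2"]) auto
qed

lemma covers_UN:
  assumes "finite I" "\<And>i. i \<in> I \<Longrightarrow> covers E (D i)"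
  shows "covers E (\<Union>i\<in>I. D i)"
  using assms
  by (induction I) (auto intro: covers_Un covers_subset)

text \<open>A rigid form of divisibility: the \<open>n\<close> disjoint pieces are exact translates
  of one set. It passes to subsets of \<open>B\<close>, which makes such sets suitable generators of
  an ideal.\<close>

definition spreads :: "nat \<Rightarrow> 'a::group_add set \<Rightarrow> 'a set \<Rightarrow> bool" where
  "spreads n A B \<longleftrightarrow> (\<exists>s. (\<forall>i\<in>{1..n}. translate (s i) B \<subseteq> A) \<and>
     disjoint_family_on (\<lambda>i. translate (s i) B) {1..n})"

text \<open>
  Every ultrafilter with a member in \<open>spread_ideal n A\<close> has at least \<open>n\<close> translates containing \<open>A\<close>.
\<close>

definition spread_ideal :: "nat \<Rightarrow> 'a::group_add set \<Rightarrow> 'a set set" where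
  "spread_ideal n A = {D. \<exists>\<B>. finite \<B> \<and> (\<forall>B\<in>\<B>. spreads n A B) \<and> D \<subseteq> \<Union>\<B>}"

lemma spreads_mono: "spreads n A B \<Longrightarrow> C \<subseteq> B \<Longrightarrow> spreads n A C"
proof -
  assume "spreads n A B" "C \<subseteq> B"
  then obtain s where "\<forall>i\<in>{1..n}. translate (s i) B \<subseteq> A"
      "disjoint_family_on (\<lambda>i. translate (s i) B) {1..n}"
    unfolding spreads_def by auto
  moreover from \<open>C \<subseteq> B\<close> have "translate g C \<subseteq> translate g B" for g
    by (auto simp: translate_def)
  ultimately show ?thesis unfolding spreads_def disjoint_family_on_def
    by (intro exI[of _ s]) blast
qed

text \<open>The sets of \<open>\<B>\<close> are absorbed one at a time, and the pieces grow only by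
  points that cause no collision. A discarded point is covered by some \<open>P k\<close> with
  \<open>k\<close> out of control; the invariant that the pieces cover each other turns this into
  being covered by every \<open>P j\<close>.\<close>

lemma spread_family:
  fixes A :: "'a::group_add set"
  assumes "finite \<B>" "\<And>B. B \<in> \<B> \<Longrightarrow> spreads n A B"
  shows "\<exists>P :: nat \<Rightarrow> 'a set. (\<forall>j\<in>{1..n}. P j \<subseteq> A \<and> covers (P j) (\<Union>\<B>)) \<and>
    (\<forall>i\<in>{1..n}. \<forall>j\<in>{1..n}. covers (P j) (P i)) \<and> disjoint_family_on P {1..n}"
  using assms
proof (induction \<B>)
  case empty
  show ?case
    by (rule exI[of _ "\<lambda>_. {}"]) (auto simp: disjoint_family_on_def intro: covers_subset)
next
  case (insert B \<B>)
  have "\<exists>P :: nat \<Rightarrow> 'a set. (\<forall>j\<in>{1..n}. P j \<subseteq> A \<and> covers (P j) (\<Union>\<B>)) \<and>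
    (\<forall>i\<in>{1..n}. \<forall>j\<in>{1..n}. covers (P j) (P i)) \<and> disjoint_family_on P {1..n}"
    by (rule insert.IH) (rule insert.prems, rule insertI2)
  then obtain P :: "nat \<Rightarrow> 'a set" where
    P: "(\<forall>j\<in>{1..n}. P j \<subseteq> A \<and> covers (P j) (\<Union>\<B>)) \<and>
      (\<forall>i\<in>{1..n}. \<forall>j\<in>{1..n}. covers (P j) (P i)) \<and> disjoint_family_on P {1..n}" ..
  note P = P[THEN conjunct1, THEN bspec, THEN conjunct1] P[THEN conjunct1, THEN bspec, THEN conjunct2]
    P[THEN conjunct2, THEN conjunct1, THEN bspec, THEN bspec] P[THEN conjunct2, THEN conjunct2]
  have "spreads n A B" using insert.prems by simp
  then obtain s where s: "(\<forall>i\<in>{1..n}. translate (s i) B \<subseteq> A) \<and>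
      disjoint_family_on (\<lambda>i. translate (s i) B) {1..n}"
    unfolding spreads_def ..
  note s = s[THEN conjunct1, THEN bspec] s[THEN conjunct2]
  \<comment> \<open>A point of \<open>B\<close> with some translate in some \<open>P k\<close> is covered by \<open>P k\<close> already.\<close>
  define C where "C = B - (\<Union>i\<in>{1..n}. \<Union>k\<in>{1..n}. translate (- s i) (P k))"
  define Q where "Q j = P j \<union> translate (s j) C" for j
  have CB: "C \<subseteq> B" by (auto simp: C_def)
  have covC: "covers (Q j) C" for j
  proof -
    have "covers (translate (s j) C) C"
      using covers_translate[of "translate (s j) C" "- s j"] by (simp add: translate_translate)
    then show ?thesis
      by (rule covers_trans[rotated]) (auto simp: Q_def intro: covers_subset)
  qed
  have covP: "covers (Q j) (P i)" if "i \<in> {1..n}" "j \<in> {1..n}" for i j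
    using P(3)[OF that] by (rule covers_trans[rotated]) (auto simp: Q_def intro: covers_subset)
  have Q1: "Q j \<subseteq> A" if "j \<in> {1..n}" for j
    using P(1)[OF that] s(1)[OF that] CB by (auto simp: Q_def translate_def)
  have Q2: "covers (Q j) (\<Union>(insert B \<B>))" if j: "j \<in> {1..n}" for j
  proof -
    have "covers (Q j) (\<Union>\<B>)"
      using P(2)[OF j] covP[OF j j] covers_trans by blast
    moreover have "covers (Q j) (\<Union>i\<in>{1..n}. \<Union>k\<in>{1..n}. translate (- s i) (P k))"
      by (intro covers_UN covers_trans[OF covP[OF _ j] covers_translate]) auto
    ultimately have "covers (Q j) (C \<union> (\<Union>i\<in>{1..n}. \<Union>k\<in>{1..n}. translate (- s i) (P k)) \<union> \<Union>\<B>)"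
      using covC by (intro covers_Un)
    then show ?thesis
      by (rule covers_trans, intro covers_subset) (auto simp: C_def)
  qed
  have Q3: "covers (Q j) (Q i)" if "i \<in> {1..n}" "j \<in> {1..n}" for i j
    using covP[OF that] covers_trans[OF covC covers_translate, of j "s i"]
    unfolding Q_def[of i] by (intro covers_Un)
  have Q4: "disjoint_family_on Q {1..n}"
  proof -
    \<comment> \<open>All pairs of indices enter the definition of \<open>C\<close>, so a new
      translate avoids the old pieces of every index, not only its own.\<close>
    have PC: "P i \<inter> translate (s j) C = {}" if "i \<in> {1..n}" "j \<in> {1..n}" for i j
    proof -
      have "s j + (- s j + x) = x" for x by (simp flip: add.assoc)
      then have "x \<notin> P i" if "- s j + x \<in> C" for x
        using that \<open>i \<in> {1..n}\<close> \<open>j \<in> {1..n}\<close> unfolding C_def mem_translate Diff_iff UN_iff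
        by (metis add.inverse_inverse)
      then show ?thesis by (auto simp: mem_translate)
    qed
    have sub: "translate (s i) C \<subseteq> translate (s i) B" for i
      using CB by (auto simp: translate_def)
    show ?thesis
      unfolding disjoint_family_on_def
    proof (intro ballI impI)
      fix i j assume ij: "i \<in> {1..n}" "j \<in> {1..n}" "i \<noteq> j"
      have "P i \<inter> P j = {}" "translate (s i) B \<inter> translate (s j) B = {}"
        using P(4) s(2) ij by (auto dest: disjoint_family_onD)
      then show "Q i \<inter> Q j = {}"
        using PC[OF ij(1,2)] PC[OF ij(2,1)] sub[of i] sub[of j] unfolding Q_def by blast
    qed
  qed
  show ?case
    using Q1 Q2 Q3 Q4 by (intro exI[of _ Q] conjI ballI) simp_all
qed

text \<open>From right to left, \<open>spread_family\<close> merges the members of a cover of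
  \<open>A\<close> into \<open>n\<close> pieces. From left to right, the \<open>n\<close> finite
  covers of \<open>A\<close> by translates of the \<open>P j\<close> have a common refinement whose
  members can be moved into every \<open>P j\<close>.\<close>

lemma n_divisible_iff:
  fixes A :: "'a::group_add set"
  assumes "A \<noteq> {}"
  shows "n_divisible n A \<longleftrightarrow> A \<in> spread_ideal n A"
proof
  assume "A \<in> spread_ideal n A"
  then obtain \<B> where \<B>: "finite \<B>" "\<And>B. B \<in> \<B> \<Longrightarrow> spreads n A B" "A \<subseteq> \<Union>\<B>"
    unfolding spread_ideal_def by blast
  obtain P :: "nat \<Rightarrow> 'a set" where P: "\<forall>j\<in>{1..n}. P j \<subseteq> A \<and> covers (P j) (\<Union>\<B>)"
    "disjoint_family_on P {1..n}"
    using spread_family[OF \<B>(1,2)] by blast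
  have "size_equiv (P j) A" if j: "j \<in> {1..n}" for j
  proof -
    have "covers (P j) A"
      using P(1) j covers_trans[OF _ covers_subset[OF \<B>(3)]] by blast
    then obtain F where F: "finite F" "A \<subseteq> (\<Union>g\<in>F. translate g (P j))"
      unfolding covers_def by blast
    then have "P j \<noteq> {}" using assms by (auto simp: translate_def)
    moreover have "P j \<subseteq> (\<Union>g\<in>{0}. translate g A)" using P(1) j by auto
    ultimately show ?thesis
      unfolding size_equiv_def propto_def using assms F by blast
  qed
  then show "n_divisible n A" unfolding n_divisible_def using P by blast
next
  assume "n_divisible n A"
  then obtain P :: "nat \<Rightarrow> 'a set" where P: "\<And>j. j \<in> {1..n} \<Longrightarrow> P j \<subseteq> A"
     "\<And>j. j \<in> {1..n} \<Longrightarrow> A \<propto> P j" "disjoint_family_on P {1..n}"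
    unfolding n_divisible_def size_equiv_def by blast
  have "\<exists>F. \<forall>j\<in>{1..n}. finite (F j) \<and> A \<subseteq> (\<Union>g\<in>F j. translate g (P j))"
    using P(2) unfolding propto_def by metis
  then obtain F where F: "\<And>j. j \<in> {1..n} \<Longrightarrow> finite (F j)"
     "\<And>j. j \<in> {1..n} \<Longrightarrow> A \<subseteq> (\<Union>g\<in>F j. translate g (P j))" by blast
  \<comment> \<open>\<open>f\<close> selects one translate from each of the \<open>n\<close> covers.
    Moving \<open>B f\<close> by \<open>- f j\<close> lands in \<open>P j\<close>, so disjointness
    is inherited from \<open>P\<close>; the selections in \<open>PiE\<close> are finite in
    number.\<close>
  define B where "B f = (\<Inter>j\<in>{1..n}. translate (f j) (P j)) \<inter> A" for f
  have "spreads n A (B f)" for f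
    unfolding spreads_def
  proof (intro exI[of _ "\<lambda>j. - f j"] conjI ballI)
    have sub: "translate (- f j) (B f) \<subseteq> P j" if "j \<in> {1..n}" for j
    proof
      fix x assume "x \<in> translate (- f j) (B f)"
      then have "f j + x \<in> B f" by (simp add: mem_translate)
      then have "f j + x \<in> translate (f j) (P j)" using that by (auto simp: B_def)
      then show "x \<in> P j" by (simp add: mem_translate)
    qed
    show "translate (- f j) (B f) \<subseteq> A" if "j \<in> {1..n}" for j
      using sub[OF that] P(1)[OF that] by blast
    show "disjoint_family_on (\<lambda>j. translate (- f j) (B f)) {1..n}"
      using sub P(3) unfolding disjoint_family_on_def by blast
  qed
  moreover have "A \<subseteq> \<Union>(B ` (PiE {1..n} F))"
  proof
    fix x assume x: "x \<in> A"
    have "\<forall>j\<in>{1..n}. \<exists>g. g \<in> F j \<and> x \<in> translate g (P j)" using F(2) x by blast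
    then obtain f where "\<forall>j\<in>{1..n}. f j \<in> F j \<and> x \<in> translate (f j) (P j)" by metis
    then have "restrict f {1..n} \<in> PiE {1..n} F" "x \<in> B (restrict f {1..n})"
      using x by (auto simp: B_def)
    then show "x \<in> \<Union>(B ` (PiE {1..n} F))" by blast
  qed
  moreover have "finite (B ` PiE {1..n} F)"
    using F(1) by (intro finite_imageI finite_PiE) auto
  ultimately show "A \<in> spread_ideal n A"
    unfolding spread_ideal_def by blast
qed

lemma spread_ideal_subset: "D \<in> spread_ideal n A \<Longrightarrow> E \<subseteq> D \<Longrightarrow> E \<in> spread_ideal n A"
  unfolding spread_ideal_def mem_Collect_eq by (meson order_trans)

lemma spread_ideal_Un:
  assumes "D \<in> spread_ideal n A" "E \<in> spread_ideal n A"
  shows "D \<union> E \<in> spread_ideal n A"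
proof -
  obtain \<B> \<C> where "finite \<B>" "\<forall>B\<in>\<B>. spreads n A B" "D \<subseteq> \<Union>\<B>"
    "finite \<C>" "\<forall>B\<in>\<C>. spreads n A B" "E \<subseteq> \<Union>\<C>"
    using assms unfolding spread_ideal_def by blast
  then have "finite (\<B> \<union> \<C>)" "\<forall>B\<in>\<B> \<union> \<C>. spreads n A B" "D \<union> E \<subseteq> \<Union>(\<B> \<union> \<C>)" by auto
  then show ?thesis unfolding spread_ideal_def by (intro CollectI exI[of _ "\<B> \<union> \<C>"]) simp
qed

lemma spread_ideal_spreads: "spreads n A B \<Longrightarrow> B \<in> spread_ideal n A"
  unfolding spread_ideal_def by (auto intro!: exI[of _ "{B}"])

section \<open>Ultrafilters\<close>

lemma ultrafilter_not_iff:
  "ultrafilter U \<Longrightarrow> eventually (\<lambda>x. \<not> P x) U \<longleftrightarrow> \<not> eventually P U"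
  unfolding ultrafilter_def using eventually_conj[of P U "\<lambda>x. \<not> P x"]
  by (auto simp: trivial_limit_def)

lemma ultrafilter_disj_iff:
  assumes "ultrafilter U"
  shows "eventually (\<lambda>x. P x \<or> Q x) U \<longleftrightarrow> eventually P U \<or> eventually Q U"
  using ultrafilter_not_iff[OF assms, of "\<lambda>x. P x \<or> Q x"] ultrafilter_not_iff[OF assms, of P]
    ultrafilter_not_iff[OF assms, of Q] by (auto simp: eventually_conj_iff)

lemma ultrafilter_Bex_iff:
  assumes "ultrafilter U" "finite I"
  shows "eventually (\<lambda>x. \<exists>i\<in>I. P i x) U \<longleftrightarrow> (\<exists>i\<in>I. eventually (P i) U)"
  using assms(2)
proof (induction I)
  case empty
  then show ?case using assms(1) by (simp add: ultrafilter_def trivial_limit_def)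
qed (simp add: ultrafilter_disj_iff[OF assms(1)])

lemma ultrafilter_eqI:
  assumes "ultrafilter U" "ultrafilter V"
    and "\<And>D. eventually (\<lambda>x. x \<in> D) U \<Longrightarrow> eventually (\<lambda>x. x \<in> D) V"
  shows "U = V"
proof (rule filter_eqI)
  fix P
  show "eventually P U \<longleftrightarrow> eventually P V"
    using assms(3)[of "{x. P x}"] assms(3)[of "{x. \<not> P x}"]
      ultrafilter_not_iff[OF assms(1), of P] ultrafilter_not_iff[OF assms(2), of P] by auto
qed

text \<open>Zorn's lemma for the reversed order, since finer filters are smaller. A non-empty chain
  is directed, so its infimum contains only what some member contains and is therefore proper. A
  minimal proper filter decides every \<open>P\<close>: if it lacks the complement, adding
  \<open>P\<close> keeps it proper and hence changes nothing.\<close>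

lemma exists_ultrafilter_le:
  assumes "F \<noteq> bot"
  shows "\<exists>U. ultrafilter U \<and> U \<le> F"
proof -
  let ?S = "{U. U \<noteq> bot \<and> U \<le> F}"
  have "\<exists>U\<in>?S. \<forall>V\<in>?S. V \<le> U \<longrightarrow> V = U"
  proof (rule predicate_Zorn[of ?S "\<lambda>x y. y \<le> x"])
    show "partial_order_on ?S (relation_of (\<lambda>x y. y \<le> x) ?S)"
      by (intro partial_order_on_relation_ofI) auto
    fix C assume C: "C \<in> Chains (relation_of (\<lambda>x y. y \<le> x) ?S)"
    show "\<exists>U\<in>?S. \<forall>V\<in>C. U \<le> V"
    proof (cases "C = {}")
      case True
      then show ?thesis using assms by auto
    next
      case False
      have CS: "C \<subseteq> ?S" using Chains_relation_of[OF C] .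
      have chain: "\<exists>x\<in>C. x \<le> inf V W" if "V \<in> C" "W \<in> C" for V W
        using C that unfolding Chains_def relation_of_def by fastforce
      have "eventually P (Inf C) \<longleftrightarrow> (\<exists>V\<in>C. eventually P V)" for P
        using False chain by (intro eventually_Inf_base) auto
      then have "Inf C \<noteq> bot"
        using CS by (auto simp: trivial_limit_def)
      moreover have "Inf C \<le> F" using False CS by (auto intro: Inf_lower2)
      ultimately show ?thesis by (intro bexI[of _ "Inf C"]) (auto intro: Inf_lower)
    qed
  qed
  then obtain U where "U \<in> ?S" and "\<forall>V\<in>?S. V \<le> U \<longrightarrow> V = U" ..
  then have U: "U \<noteq> bot" "U \<le> F" "\<And>V. V \<noteq> bot \<Longrightarrow> V \<le> F \<Longrightarrow> V \<le> U \<Longrightarrow> V = U"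
    by simp_all
  have "eventually P U \<or> eventually (\<lambda>x. \<not> P x) U" for P
  proof (rule disjCI)
    assume n: "\<not> eventually (\<lambda>x. \<not> P x) U"
    let ?V = "inf U (principal {x. P x})"
    have "?V \<noteq> bot"
      using n by (simp add: trivial_limit_def eventually_inf_principal)
    then have "?V = U" using U(2) by (intro U(3)) (auto intro: le_infI1)
    then have "U \<le> principal {x. P x}" by (metis inf.cobounded2)
    then show "eventually P U" by (simp add: le_principal)
  qed
  then show ?thesis using U by (auto simp: ultrafilter_def)
qed

text \<open>The sets \<open>A - D\<close> form a filter base because \<open>J\<close> is closed
  under unions, and none is empty because \<open>A\<close> is not in \<open>J\<close>. It is applied
  to \<open>spread_ideal\<close> and, in place of a compactness argument, to an ideal defined by a
  discrete invariant set.\<close>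

lemma exists_ultrafilter_avoiding:
  assumes sub: "\<And>D E. D \<in> J \<Longrightarrow> E \<subseteq> D \<Longrightarrow> E \<in> J"
    and Un: "\<And>D E. D \<in> J \<Longrightarrow> E \<in> J \<Longrightarrow> D \<union> E \<in> J"
    and "{} \<in> J" "A \<notin> J"
  shows "\<exists>U. ultrafilter U \<and> eventually (\<lambda>x. x \<in> A) U \<and> (\<forall>D\<in>J. \<not> eventually (\<lambda>x. x \<in> D) U)"
proof -
  define F where "F = (INF D\<in>J. principal (A - D))"
  have ev: "eventually P F \<longleftrightarrow> (\<exists>D\<in>J. \<forall>x\<in>A - D. P x)" for P
    unfolding F_def
  proof (subst eventually_INF_base)
    show "\<exists>x\<in>J. principal (A - x) \<le> inf (principal (A - D)) (principal (A - E))"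
      if "D \<in> J" "E \<in> J" for D E
      using Un[OF that] by (intro bexI[of _ "D \<union> E"]) auto
  qed (use \<open>{} \<in> J\<close> in \<open>auto simp: eventually_principal\<close>)
  have "F \<noteq> bot"
    unfolding trivial_limit_def ev using sub \<open>A \<notin> J\<close> by blast
  then obtain U where U: "ultrafilter U" "U \<le> F" using exists_ultrafilter_le by blast
  have "eventually (\<lambda>x. x \<in> A - D) U" if "D \<in> J" for D
    using U(2) that by (intro filter_leD[OF U(2)]) (auto simp: ev)
  then have *: "eventually (\<lambda>x. x \<in> A) U" "\<forall>D\<in>J. eventually (\<lambda>x. \<not> x \<in> D) U"
    using \<open>{} \<in> J\<close> by (auto simp: eventually_conj_iff)
  then show ?thesis
    using U(1) by (intro exI[of _ U]) (simp add: ultrafilter_not_iff)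
qed

text \<open>
  A maximal set \<open>B\<close> disjoint from its translate by \<open>t\<close> covers the group together with its
  translates by \<open>t\<close> and \<open>- t\<close>; hence every ultrafilter contains a set disjoint from its translate.
\<close>

lemma ultrafilter_free:
  fixes t :: "'a::group_add"
  assumes "ultrafilter U" "t \<noteq> 0"
  shows "\<exists>E. eventually (\<lambda>x. x \<in> E) U \<and> (\<forall>x\<in>E. t + x \<notin> E)"
proof -
  let ?S = "{B. \<forall>x\<in>B. t + x \<notin> B}"
  have "\<exists>M\<in>?S. \<forall>X\<in>?S. M \<subseteq> X \<longrightarrow> X = M"
  proof (rule subset_Zorn')
    fix C assume C: "subset.chain ?S C"
    have False if "x \<in> X" "X \<in> C" "t + x \<in> Y" "Y \<in> C" for x X Y
    proof -
      have "X \<subseteq> Y \<or> Y \<subseteq> X" "X \<in> ?S" "Y \<in> ?S"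
        using C that by (auto simp: subset_chain_def)
      then show False using that(1,3) by auto
    qed
    then show "\<Union> C \<in> ?S" by blast
  qed
  then obtain B where "B \<in> ?S" and max: "\<forall>X\<in>?S. B \<subseteq> X \<longrightarrow> X = B" ..
  then have B: "\<forall>x\<in>B. t + x \<notin> B" by simp
  \<comment> \<open>Otherwise \<open>insert x B\<close> would be a strictly larger admissible set;
    \<open>t + x\<close> differs from \<open>x\<close> because \<open>t\<close> is not zero.\<close>
  have cov: "x \<in> B \<or> t + x \<in> B \<or> - t + x \<in> B" for x
  proof (rule ccontr)
    assume a: "\<not> (x \<in> B \<or> t + x \<in> B \<or> - t + x \<in> B)"
    have "t + x \<noteq> x" using assms(2) add_right_cancel[of t x 0] by (simp del: add_right_cancel)
    moreover have "t + y \<noteq> x" if "y \<in> B" for y using a that by auto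
    ultimately have "\<forall>y\<in>insert x B. t + y \<notin> insert x B" using a B by auto
    then have "insert x B \<in> ?S" by simp
    with max have "insert x B = B" by (meson subset_insertI)
    then show False using a by blast
  qed
  have "eventually (\<lambda>x. x \<in> B \<or> t + x \<in> B \<or> - t + x \<in> B) U" using cov by simp
  then have "eventually (\<lambda>x. x \<in> B) U \<or> eventually (\<lambda>x. x \<in> {x. t + x \<in> B}) U
      \<or> eventually (\<lambda>x. x \<in> {x. - t + x \<in> B}) U"
    by (simp add: ultrafilter_disj_iff[OF assms(1)])
  then consider "eventually (\<lambda>x. x \<in> B) U" | "eventually (\<lambda>x. x \<in> {x. t + x \<in> B}) U"
      | "eventually (\<lambda>x. x \<in> {x. - t + x \<in> B}) U" by argo
  note cases = this
  have B1: "\<forall>x\<in>{x. t + x \<in> B}. t + x \<notin> {x. t + x \<in> B}"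
    using B by auto
  have B2: "\<forall>x\<in>{x. - t + x \<in> B}. t + x \<notin> {x. - t + x \<in> B}"
  proof safe
    fix x assume "- t + x \<in> B" "- t + (t + x) \<in> B"
    then show False using B[rule_format, of "- t + x"] by simp
  qed
  from cases show ?thesis
    by cases (rule exI, erule conjI, fact B B1 B2)+
qed

lemma finite_returns_of_not_divisible:
  fixes A :: "'a::group_add set"
  assumes "A \<noteq> {}" "\<not> n_divisible n A"
  shows "\<exists>U. ultrafilter U \<and> eventually (\<lambda>x. x \<in> A) U \<and>
    finite {g. eventually (\<lambda>x. g + x \<in> A) U}"
proof -
  have "A \<notin> spread_ideal n A" using assms n_divisible_iff by blast
  moreover have "{} \<in> spread_ideal n A" unfolding spread_ideal_def by auto
  ultimately obtain U where U: "ultrafilter U" "eventually (\<lambda>x. x \<in> A) U"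
     "\<And>D. D \<in> spread_ideal n A \<Longrightarrow> \<not> eventually (\<lambda>x. x \<in> D) U"
    using exists_ultrafilter_avoiding[of "spread_ideal n A" A] spread_ideal_subset spread_ideal_Un
    by metis
  let ?R = "{g. eventually (\<lambda>x. g + x \<in> A) U}"
  have "finite ?R"
  proof (rule ccontr)
    assume "infinite ?R"
    then obtain R where R: "R \<subseteq> ?R" "finite R" "card R = n"
      using infinite_arbitrarily_large by blast
    obtain s where s: "bij_betw s {1..n} R"
      using R finite_same_card_bij[of "{1..n}" R] by auto
    \<comment> \<open>The translates of a set by \<open>s i\<close> and \<open>s j\<close> meet
      exactly when the set meets its own translate by \<open>- s i + s j\<close>. The dummy choice
      on the diagonal makes \<open>E\<close> a function of all pairs, so that intersecting finitely
      many members of \<open>U\<close> yields the spreading set \<open>B\<close>.\<close>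
    have "\<exists>E. eventually (\<lambda>x. x \<in> E) U \<and> (i \<noteq> j \<longrightarrow> (\<forall>x\<in>E. (- s i + s j) + x \<notin> E))"
      if "i \<in> {1..n}" "j \<in> {1..n}" for i j
    proof (cases "i = j")
      case True
      then show ?thesis by (intro exI[of _ UNIV]) auto
    next
      case False
      then have "s i \<noteq> s j" using s that by (metis bij_betw_imp_inj_on inj_on_eq_iff)
      then have "- s i + s j \<noteq> 0" using neg_eq_iff_add_eq_0[of "- s i" "s j"] by auto
      then show ?thesis using ultrafilter_free[OF U(1)] by blast
    qed
    then obtain E where E: "\<And>i j. i \<in> {1..n} \<Longrightarrow> j \<in> {1..n} \<Longrightarrow> eventually (\<lambda>x. x \<in> E i j) U"
      "\<And>i j x. i \<in> {1..n} \<Longrightarrow> j \<in> {1..n} \<Longrightarrow> i \<noteq> j \<Longrightarrow> x \<in> E i j \<Longrightarrow> (- s i + s j) + x \<notin> E i j"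
      by metis
    define B where "B = {x. \<forall>i\<in>{1..n}. s i + x \<in> A \<and> (\<forall>j\<in>{1..n}. x \<in> E i j)}"
    have "s i \<in> ?R" if "i \<in> {1..n}" for i
      using R(1) bij_betwE[OF s] that by blast
    then have "eventually (\<lambda>x. x \<in> B) U"
      unfolding B_def using E(1)
      by (auto intro!: eventually_ball_finite eventually_conj ballI)
    moreover have "spreads n A B"
      unfolding spreads_def
    proof (intro exI[of _ s] conjI ballI)
      show "translate (s i) B \<subseteq> A" if "i \<in> {1..n}" for i
        using that by (auto simp: translate_def B_def)
      show "disjoint_family_on (\<lambda>i. translate (s i) B) {1..n}"
        unfolding disjoint_family_on_def
      proof safe
        fix i j x assume ij: "i \<in> {1..n}" "j \<in> {1..n}" "i \<noteq> j"
          and x: "x \<in> translate (s i) B" "x \<in> translate (s j) B"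
        have "- s i + s j + (- s j + x) = - s i + x" by (simp add: add.assoc)
        then have "(- s i + s j) + (- s j + x) \<in> E i j"
          using x ij by (auto simp: mem_translate B_def)
        moreover have "- s j + x \<in> E i j" using x ij by (auto simp: mem_translate B_def)
        ultimately show "x \<in> {}" using E(2)[OF ij] by blast
      qed
    qed
    ultimately show False using U(3) spread_ideal_spreads by blast
  qed
  then show ?thesis using U by blast
qed

section \<open>Orbits in the Stone--Cech compactification\<close>

lemma openin_betaG_basic: "openin betaG {U. ultrafilter U \<and> (\<forall>\<^sub>F x in U. x \<in> D)}"
  unfolding betaG_def by (rule topology_generated_by_Basis) blast

text \<open>The generating sets are declared only as a subbase. They form a base because those of
  \<open>D\<close> and \<open>E\<close> intersect in that of \<open>D \<inter> E\<close>.\<close>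

lemma openin_betaG:
  "openin betaG T \<longleftrightarrow> T \<subseteq> {U. ultrafilter U} \<and>
     (\<forall>U\<in>T. \<exists>D. (\<forall>\<^sub>F x in U. x \<in> D) \<and> (\<forall>V. ultrafilter V \<and> (\<forall>\<^sub>F x in V. x \<in> D) \<longrightarrow> V \<in> T))"
  (is "?l \<longleftrightarrow> ?r T")
proof
  assume ?l
  then have "generate_topology_on
      (range (\<lambda>B. {U. ultrafilter U \<and> (\<forall>\<^sub>F x in U. x \<in> B)})) T"
    unfolding betaG_def by (rule openin_topology_generated_by)
  then show "?r T"
  proof (induction rule: generate_topology_on.induct)
    case (Int a b)
    show ?case
    proof (intro conjI ballI)
      fix U assume "U \<in> a \<inter> b"
      then have U: "U \<in> a" "U \<in> b" by auto
      obtain D where "(\<forall>\<^sub>F x in U. x \<in> D) \<and> (\<forall>V. ultrafilter V \<and> (\<forall>\<^sub>F x in V. x \<in> D) \<longrightarrow> V \<in> a)"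
        using Int.IH(1)[THEN conjunct2, THEN bspec, OF U(1)] ..
      moreover obtain E where "(\<forall>\<^sub>F x in U. x \<in> E) \<and> (\<forall>V. ultrafilter V \<and> (\<forall>\<^sub>F x in V. x \<in> E) \<longrightarrow> V \<in> b)"
        using Int.IH(2)[THEN conjunct2, THEN bspec, OF U(2)] ..
      ultimately show "\<exists>D. (\<forall>\<^sub>F x in U. x \<in> D) \<and> (\<forall>V. ultrafilter V \<and> (\<forall>\<^sub>F x in V. x \<in> D) \<longrightarrow> V \<in> a \<inter> b)"
        by (intro exI[of _ "D \<inter> E"]) (simp add: eventually_conj_iff)
    qed (use Int in auto)
  next
    case (UN K)
    show ?case
    proof (intro conjI ballI)
      fix U assume "U \<in> \<Union>K"
      then obtain k where k: "k \<in> K" "U \<in> k" by auto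
      obtain D where "(\<forall>\<^sub>F x in U. x \<in> D) \<and> (\<forall>V. ultrafilter V \<and> (\<forall>\<^sub>F x in V. x \<in> D) \<longrightarrow> V \<in> k)"
        using UN.IH[OF k(1), THEN conjunct2, THEN bspec, OF k(2)] ..
      with k show "\<exists>D. (\<forall>\<^sub>F x in U. x \<in> D) \<and> (\<forall>V. ultrafilter V \<and> (\<forall>\<^sub>F x in V. x \<in> D) \<longrightarrow> V \<in> \<Union>K)"
        by (intro exI[of _ D]) auto
    qed (use UN in auto)
  next
    case (Basis s)
    then obtain B where "s = {U. ultrafilter U \<and> (\<forall>\<^sub>F x in U. x \<in> B)}" by blast
    then show ?case by (auto intro!: exI[of _ B])
  qed simp
next
  assume r: "?r T"
  show ?l
  proof (subst openin_subopen, intro ballI)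
    fix U assume U: "U \<in> T"
    obtain D where D: "(\<forall>\<^sub>F x in U. x \<in> D) \<and> (\<forall>V. ultrafilter V \<and> (\<forall>\<^sub>F x in V. x \<in> D) \<longrightarrow> V \<in> T)"
      using r[THEN conjunct2, THEN bspec, OF U] ..
    show "\<exists>S. openin betaG S \<and> U \<in> S \<and> S \<subseteq> T"
    proof (intro exI conjI)
      show "openin betaG {U. ultrafilter U \<and> (\<forall>\<^sub>F x in U. x \<in> D)}"
        by (rule openin_betaG_basic)
    qed (use U r D in auto)
  qed
qed

lemma openin_betaGE:
  assumes "openin betaG T" "U \<in> T"
  obtains D where "\<forall>\<^sub>F x in U. x \<in> D" "\<And>V. ultrafilter V \<Longrightarrow> \<forall>\<^sub>F x in V. x \<in> D \<Longrightarrow> V \<in> T"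
proof -
  obtain D where "(\<forall>\<^sub>F x in U. x \<in> D) \<and> (\<forall>V. ultrafilter V \<and> (\<forall>\<^sub>F x in V. x \<in> D) \<longrightarrow> V \<in> T)"
    using assms(1)[unfolded openin_betaG, THEN conjunct2, THEN bspec, OF assms(2)] ..
  then show ?thesis by (intro that[of D]) auto
qed

text \<open>The basic open set of \<open>D\<close> contains \<open>principal {b}\<close> exactly
  when \<open>b \<in> D\<close>. So \<open>U\<close> is adherent iff all its members meet
  \<open>B\<close>, and for an ultrafilter this means that \<open>B\<close> is a member.\<close>

lemma K_set_eq: "K_set B = {U. ultrafilter U \<and> (\<forall>\<^sub>F x in U. x \<in> B)}"
proof (intro set_eqI iffI)
  fix U assume "U \<in> K_set B"
  then have U: "ultrafilter U"
    "\<And>T. U \<in> T \<Longrightarrow> openin betaG T \<Longrightarrow> \<exists>b\<in>B. principal {b} \<in> T"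
    unfolding K_set_def in_closure_of topspace_betaG by auto
  have "\<not> (\<forall>\<^sub>F x in U. x \<in> - B)"
    using U(2)[OF _ openin_betaG_basic[of "- B"]] U(1)
    by (auto simp: eventually_principal)
  then show "U \<in> {U. ultrafilter U \<and> (\<forall>\<^sub>F x in U. x \<in> B)}"
    using U(1) ultrafilter_not_iff[OF U(1), of "\<lambda>x. x \<in> B"] by simp
next
  fix U assume "U \<in> {U. ultrafilter U \<and> (\<forall>\<^sub>F x in U. x \<in> B)}"
  then have U: "ultrafilter U" "\<forall>\<^sub>F x in U. x \<in> B" by auto
  show "U \<in> K_set B"
    unfolding K_set_def in_closure_of topspace_betaG
  proof (intro conjI allI impI, goal_cases)
    case (2 T)
    then obtain D where D: "\<forall>\<^sub>F x in U. x \<in> D" "\<And>V. ultrafilter V \<Longrightarrow> \<forall>\<^sub>F x in V. x \<in> D \<Longrightarrow> V \<in> T"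
      using openin_betaGE by metis
    have "\<forall>\<^sub>F x in U. x \<in> B \<and> x \<in> D" using U(2) D(1) by (rule eventually_conj)
    then have "\<exists>x. x \<in> B \<and> x \<in> D"
      using U(1) unfolding ultrafilter_def by (blast intro: eventually_happens')
    then obtain x where "x \<in> B" "x \<in> D" by blast
    with D(2) ultrafilter_principal[of x] have "principal {x} \<in> T"
      by (simp add: eventually_principal)
    with \<open>x \<in> B\<close> show ?case by blast
  qed (use U in simp)
qed

lemma X_set_eq: "X_set A = {U. ultrafilter U \<and> (\<exists>g. \<forall>\<^sub>F x in U. g + x \<in> A)}"
proof -
  have "(\<exists>g. \<forall>\<^sub>F x in U. - g + x \<in> A) \<longleftrightarrow> (\<exists>g. \<forall>\<^sub>F x in U. g + x \<in> A)" for U :: "'a filter"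
    by (metis add.inverse_inverse)
  then show ?thesis
    by (auto simp: X_set_def K_set_eq mem_translate)
qed

lemma X_set_subset: "X_set A \<subseteq> topspace betaG"
  by (auto simp: X_set_eq topspace_betaG)

lemma topspace_X_top [simp]: "topspace (X_top A) = X_set A"
  using X_set_subset by (auto simp: X_top_def)

lemma eventually_beta_act: "eventually P (beta_act g U) \<longleftrightarrow> (\<forall>\<^sub>F x in U. P (g + x))"
  by (simp add: beta_act_def eventually_filtermap)

lemma beta_act_beta_act: "beta_act g (beta_act h U) = beta_act (g + h) U"
  by (simp add: beta_act_def filtermap_filtermap add.assoc)

section \<open>Orbits with finitely many returns to \<open>A\<close>, and discrete invariant
  sets\<close>

lemma separate_from_finite:
  assumes "ultrafilter U" "finite \<V>" "\<And>V. V \<in> \<V> \<Longrightarrow> ultrafilter V \<and> V \<noteq> U"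
  shows "\<exists>D. (\<forall>\<^sub>F x in U. x \<in> D) \<and> (\<forall>V\<in>\<V>. \<not> (\<forall>\<^sub>F x in V. x \<in> D))"
proof -
  have "\<forall>V\<in>\<V>. \<exists>D. (\<forall>\<^sub>F x in U. x \<in> D) \<and> \<not> (\<forall>\<^sub>F x in V. x \<in> D)"
  proof
    fix V assume V: "V \<in> \<V>"
    show "\<exists>D. (\<forall>\<^sub>F x in U. x \<in> D) \<and> \<not> (\<forall>\<^sub>F x in V. x \<in> D)"
    proof (rule ccontr)
      assume "\<nexists>D. (\<forall>\<^sub>F x in U. x \<in> D) \<and> \<not> (\<forall>\<^sub>F x in V. x \<in> D)"
      then have "U = V" using assms(1) assms(3)[OF V] by (intro ultrafilter_eqI) auto
      with assms(3)[OF V] show False by simp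
    qed
  qed
  then obtain D where D: "\<forall>V\<in>\<V>. (\<forall>\<^sub>F x in U. x \<in> D V) \<and> \<not> (\<forall>\<^sub>F x in V. x \<in> D V)"
    by (auto dest!: bchoice)
  have "\<forall>\<^sub>F x in U. x \<in> (\<Inter>V\<in>\<V>. D V)"
    using D assms(2) by (auto intro!: eventually_ball_finite)
  moreover have "\<not> (\<forall>\<^sub>F x in V. x \<in> (\<Inter>V\<in>\<V>. D V))" if "V \<in> \<V>" for V
  proof
    assume "\<forall>\<^sub>F x in V. x \<in> (\<Inter>V\<in>\<V>. D V)"
    then have "\<forall>\<^sub>F x in V. x \<in> D V" by (rule eventually_mono) (use that in auto)
    with D that show False by blast
  qed
  ultimately show ?thesis by (intro exI[of _ "\<Inter>V\<in>\<V>. D V"]) auto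
qed

text \<open>\<open>V\<close> contains some \<open>translate (- k) A\<close>, and the only orbit
  points containing it are \<open>beta_act (- k + r) U\<close> with \<open>r\<close> a return to
  \<open>A\<close>; these finitely many can be separated from \<open>V\<close>. For \<open>V\<close>
  off the orbit this yields closedness, for \<open>V\<close> on it discreteness.\<close>

lemma orbit_isolated:
  fixes A :: "'a::group_add set"
  assumes U: "ultrafilter U" and fin: "finite {g. \<forall>\<^sub>F x in U. g + x \<in> A}" and V: "V \<in> X_set A"
  shows "\<exists>D. (\<forall>\<^sub>F x in V. x \<in> D) \<and>
    (\<forall>g. (\<forall>\<^sub>F x in beta_act g U. x \<in> D) \<longrightarrow> beta_act g U = V)"
proof -
  obtain k where k: "\<forall>\<^sub>F x in V. k + x \<in> A" and uV: "ultrafilter V"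
    using V by (auto simp: X_set_eq)
  let ?R = "{g. \<forall>\<^sub>F x in U. g + x \<in> A}"
  define \<V> where "\<V> = (\<lambda>r. beta_act (- k + r) U) ` ?R - {V}"
  obtain D where D: "\<forall>\<^sub>F x in V. x \<in> D" "\<forall>W\<in>\<V>. \<not> (\<forall>\<^sub>F x in W. x \<in> D)"
    using separate_from_finite[OF uV, of \<V>] fin ultrafilter_beta_act[OF U] by (auto simp: \<V>_def)
  have "beta_act g U = V" if g: "\<forall>\<^sub>F x in beta_act g U. x \<in> D \<and> k + x \<in> A" for g
  proof (rule ccontr)
    assume "beta_act g U \<noteq> V"
    have "k + g \<in> ?R"
      using g by (simp add: eventually_conj_iff eventually_beta_act add.assoc)
    then have "beta_act (- k + (k + g)) U \<in> (\<lambda>r. beta_act (- k + r) U) ` ?R" by (rule imageI)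
    then have "beta_act g U \<in> \<V>"
      using \<open>beta_act g U \<noteq> V\<close> by (simp add: \<V>_def)
    with D(2) g show False by (simp add: eventually_conj_iff)
  qed
  with D(1) k show ?thesis
    by (intro exI[of _ "{x. x \<in> D \<and> k + x \<in> A}"]) (simp add: eventually_conj_iff)
qed

text \<open>The required set is the orbit of \<open>U\<close>. A single orbit has no proper
  non-empty invariant subset, so what remains is topological and comes from
  \<open>orbit_isolated\<close>.\<close>

lemma discrete_minimal_of_finite_returns:
  fixes A :: "'a::group_add set"
  assumes U: "ultrafilter U" and UA: "\<forall>\<^sub>F x in U. x \<in> A"
    and fin: "finite {g. \<forall>\<^sub>F x in U. g + x \<in> A}"
  shows "\<exists>M. minimal_closed_invariant A M \<and> subtopology (X_top A) M = discrete_topology M"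
proof (intro exI conjI)
  define M where "M = range (\<lambda>g. beta_act g U)"
  note iso = orbit_isolated[OF U fin]
  have MX: "M \<subseteq> X_set A"
  proof
    fix V assume "V \<in> M"
    then obtain g where g: "V = beta_act g U" by (auto simp: M_def)
    have "\<forall>\<^sub>F x in V. - g + x \<in> A" using UA by (simp add: g eventually_beta_act)
    then show "V \<in> X_set A" using ultrafilter_beta_act[OF U] by (auto simp: X_set_eq g)
  qed
  have "openin (X_top A) (X_set A - M)"
  proof (subst openin_subopen, intro ballI)
    fix V assume V: "V \<in> X_set A - M"
    then obtain D where D: "\<forall>\<^sub>F x in V. x \<in> D"
        "\<forall>g. (\<forall>\<^sub>F x in beta_act g U. x \<in> D) \<longrightarrow> beta_act g U = V"
      using iso[of V] by auto
    let ?T = "{W. ultrafilter W \<and> (\<forall>\<^sub>F x in W. x \<in> D)} \<inter> X_set A"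
    have "openin (X_top A) ?T"
      unfolding X_top_def openin_subtopology using openin_betaG_basic by blast
    moreover have "?T \<inter> M = {}" using D(2) V by (auto simp: M_def)
    moreover have "V \<in> ?T" using V D(1) by (auto simp: X_set_eq)
    ultimately show "\<exists>T. openin (X_top A) T \<and> V \<in> T \<and> T \<subseteq> X_set A - M"
      by (intro exI[of _ ?T]) blast
  qed
  then have "closedin (X_top A) M" using MX by (simp add: closedin_def)
  moreover have "G_invariant M"
    by (auto simp: G_invariant_def M_def beta_act_beta_act)
  moreover have "N = M" if N: "N \<subseteq> M" "N \<noteq> {}" "G_invariant N" for N
  proof -
    obtain g where "beta_act g U \<in> N" using N by (auto simp: M_def)
    then have "beta_act (h - g) (beta_act g U) \<in> N" for h
      using N(3) unfolding G_invariant_def by blast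
    then have "M \<subseteq> N" by (auto simp: M_def beta_act_beta_act)
    with N(1) show ?thesis by blast
  qed
  ultimately show "minimal_closed_invariant A M"
    unfolding minimal_closed_invariant_def by (auto simp: M_def)
  have "openin (subtopology betaG M) {V}" if V: "V \<in> M" for V
  proof -
    obtain D where D: "\<forall>\<^sub>F x in V. x \<in> D"
        "\<forall>g. (\<forall>\<^sub>F x in beta_act g U. x \<in> D) \<longrightarrow> beta_act g U = V"
      using iso[of V] V MX by auto
    have "{V} = {W. ultrafilter W \<and> (\<forall>\<^sub>F x in W. x \<in> D)} \<inter> M"
      using D V ultrafilter_beta_act[OF U] by (auto simp: M_def)
    then show ?thesis unfolding openin_subtopology using openin_betaG_basic by blast
  qed
  moreover have "topspace (subtopology betaG M) = M"
    using MX X_set_subset by (auto simp: topspace_subtopology)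
  ultimately have "discrete_topology M = subtopology betaG M"
    by (simp add: discrete_topology_unique)
  then show "subtopology (X_top A) M = discrete_topology M"
    using MX by (simp add: X_top_def subtopology_subtopology Int_absorb1)
qed

text \<open>A pigeonhole argument: only finitely many points of \<open>M\<close> contain
  \<open>A\<close>, while disjoint pieces equivalent to \<open>A\<close> belong to different points
  of \<open>M\<close>.\<close>

lemma not_infinitely_divisible_of_discrete:
  fixes A :: "'a::group_add set"
  assumes "M \<noteq> {}" "closedin (X_top A) M" "G_invariant M"
    and disc: "subtopology (X_top A) M = discrete_topology M"
  shows "\<not> infinitely_divisible A"
proof
  assume div: "infinitely_divisible A"
  have MX: "M \<subseteq> X_set A" using closedin_subset[OF assms(2)] by simp
  obtain V where "V \<in> M" using assms(1) by blast
  moreover from this MX obtain g where "\<forall>\<^sub>F x in V. g + x \<in> A" by (auto simp: X_set_eq)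
  ultimately obtain g where V: "V \<in> M" "\<forall>\<^sub>F x in V. g + x \<in> A" by blast
  define U where "U = beta_act g V"
  have UM: "U \<in> M" using assms(3) V(1) by (simp add: G_invariant_def U_def)
  then have U: "ultrafilter U" using MX by (auto simp: X_set_eq)
  have UA: "\<forall>\<^sub>F x in U. x \<in> A" using V(2) by (simp add: U_def eventually_beta_act)
  \<comment> \<open>The sets that only finitely many points of \<open>M\<close> contain; they form
    an ideal. If \<open>A\<close> were not in it, some ultrafilter containing \<open>A\<close> would
    avoid it, although every point of \<open>X_set A\<close> has a member in
    \<open>J\<close>.\<close>
  define J where "J = {D. finite {W\<in>M. \<forall>\<^sub>F x in W. x \<in> D}}"
  have "\<exists>D. (\<forall>\<^sub>F x in W. x \<in> D) \<and> D \<in> J" if W: "W \<in> X_set A" for W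
  proof -
    \<comment> \<open>Discreteness provides \<open>T\<close> when \<open>W\<close> is in
      \<open>M\<close>, closedness of \<open>M\<close> when it is not; in the latter case
      \<open>T \<inter> M\<close> is empty.\<close>
    have "\<exists>T. openin (X_top A) T \<and> W \<in> T \<and> T \<inter> M \<subseteq> {W}"
    proof (cases "W \<in> M")
      case True
      have "openin (subtopology (X_top A) M) {W}"
        unfolding disc using True by simp
      then obtain T where "openin (X_top A) T" "{W} = T \<inter> M"
        unfolding openin_subtopology by auto
      then show ?thesis by (intro exI[of _ T]) auto
    next
      case False
      then show ?thesis
        using assms(2) W by (intro exI[of _ "X_set A - M"]) (auto simp: closedin_def)
    qed
    then obtain T where T: "openin betaG T" "W \<in> T" "T \<inter> X_set A \<inter> M \<subseteq> {W}"
      unfolding X_top_def openin_subtopology by auto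
    obtain D where D: "\<forall>\<^sub>F x in W. x \<in> D" "\<And>V. ultrafilter V \<Longrightarrow> \<forall>\<^sub>F x in V. x \<in> D \<Longrightarrow> V \<in> T"
      using openin_betaGE[OF T(1,2)] by metis
    have "{W'\<in>M. \<forall>\<^sub>F x in W'. x \<in> D} \<subseteq> {W}"
    proof safe
      fix W' assume W': "W' \<in> M" "\<forall>\<^sub>F x in W'. x \<in> D"
      have "W' \<in> X_set A" using W'(1) MX by blast
      moreover from this have "W' \<in> T" using D(2) W'(2) by (simp add: X_set_eq)
      ultimately show "W' = W" using W'(1) T(3) by blast
    qed
    then have "D \<in> J" unfolding J_def using finite_subset by blast
    with D(1) show ?thesis by blast
  qed
  note iso = this
  have "A \<in> J"
  proof (rule ccontr)
    assume "A \<notin> J"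
    moreover have "{} \<in> J"
    proof -
      have "\<not> (\<forall>\<^sub>F x in W. x \<in> {})" if "W \<in> M" for W
        using that MX by (auto simp: X_set_eq ultrafilter_def trivial_limit_def)
      then have "{W\<in>M. \<forall>\<^sub>F x in W. x \<in> {}} = {}" by blast
      then show ?thesis unfolding J_def by (metis finite.emptyI mem_Collect_eq)
    qed
    moreover have "E \<in> J" if "D \<in> J" "E \<subseteq> D" for D E
    proof -
      have "{W\<in>M. \<forall>\<^sub>F x in W. x \<in> E} \<subseteq> {W\<in>M. \<forall>\<^sub>F x in W. x \<in> D}"
        using that(2) by (auto elim!: eventually_mono)
      then show ?thesis using that(1) unfolding J_def by (auto intro: finite_subset)
    qed
    moreover have "D \<union> E \<in> J" if "D \<in> J" "E \<in> J" for D E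
    proof -
      have "{W\<in>M. \<forall>\<^sub>F x in W. x \<in> D \<union> E} \<subseteq> {W\<in>M. \<forall>\<^sub>F x in W. x \<in> D} \<union> {W\<in>M. \<forall>\<^sub>F x in W. x \<in> E}"
        using MX by (auto simp: X_set_eq ultrafilter_disj_iff)
      then show ?thesis using that unfolding J_def by (auto intro: finite_subset)
    qed
    ultimately obtain W where W: "ultrafilter W" "\<forall>\<^sub>F x in W. x \<in> A" "\<forall>D\<in>J. \<not> (\<forall>\<^sub>F x in W. x \<in> D)"
      using exists_ultrafilter_avoiding[of J A] by auto
    then have "W \<in> X_set A" by (auto simp: X_set_eq intro!: exI[of _ 0])
    with iso W(3) show False by blast
  qed
  then have fin: "finite {W\<in>M. \<forall>\<^sub>F x in W. x \<in> A}" (is "finite ?S") by (simp add: J_def)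
  \<comment> \<open>One piece more than there are points of \<open>M\<close> to contain
    them.\<close>
  define n where "n = Suc (card ?S)"
  have "n_divisible n A" using div by (simp add: infinitely_divisible_def n_def)
  then obtain P :: "nat \<Rightarrow> 'a set" where P: "\<forall>j\<in>{1..n}. P j \<subseteq> A \<and> size_equiv (P j) A"
     "disjoint_family_on P {1..n}"
    unfolding n_divisible_def by auto
  \<comment> \<open>Finitely many translates of \<open>P j\<close> cover \<open>A\<close>, which is
    a member of \<open>U\<close>, so one of them is in \<open>U\<close>; moving back stays in
    \<open>M\<close> by invariance.\<close>
  have "\<exists>W\<in>M. \<forall>\<^sub>F x in W. x \<in> P j" if j: "j \<in> {1..n}" for j
  proof -
    have "A \<propto> P j" using P(1) j by (simp add: size_equiv_def)
    then obtain F where F: "finite F" "A \<subseteq> (\<Union>g\<in>F. translate g (P j))" by (auto simp: propto_def)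
    have "\<exists>g\<in>F. - g + x \<in> P j" if "x \<in> A" for x
      using subsetD[OF F(2) that] by (simp add: mem_translate)
    with UA have "\<forall>\<^sub>F x in U. \<exists>g\<in>F. - g + x \<in> P j"
      by (rule eventually_mono)
    then obtain g where "g \<in> F" "\<forall>\<^sub>F x in U. - g + x \<in> P j"
      unfolding ultrafilter_Bex_iff[OF U F(1)] by blast
    then have "\<forall>\<^sub>F x in beta_act (- g) U. x \<in> P j" by (simp add: eventually_beta_act)
    moreover have "beta_act (- g) U \<in> M" using assms(3) UM by (simp add: G_invariant_def)
    ultimately show ?thesis by blast
  qed
  then have "\<forall>j\<in>{1..n}. \<exists>W. W \<in> M \<and> (\<forall>\<^sub>F x in W. x \<in> P j)" by blast
  then obtain W where W: "\<forall>j\<in>{1..n}. W j \<in> M \<and> (\<forall>\<^sub>F x in W j. x \<in> P j)"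
    by (auto dest!: bchoice)
  have "inj_on W {1..n}"
  proof (rule inj_onI, rule ccontr)
    fix i j assume ij: "i \<in> {1..n}" "j \<in> {1..n}" "W i = W j" "i \<noteq> j"
    then have "P i \<inter> P j = {}" using P(2) by (auto dest: disjoint_family_onD)
    have "\<forall>\<^sub>F x in W i. x \<in> P i \<and> x \<in> P j"
      using bspec[OF W ij(1)] bspec[OF W ij(2)] ij(3) by (simp add: eventually_conj_iff)
    then have "\<forall>\<^sub>F x in W i. False"
      by (rule eventually_mono) (use \<open>P i \<inter> P j = {}\<close> in auto)
    moreover have "W i \<noteq> bot" using W ij(1) MX by (auto simp: X_set_eq ultrafilter_def)
    ultimately show False by (simp add: trivial_limit_def)
  qed
  moreover have "W ` {1..n} \<subseteq> ?S"
  proof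
    fix V assume "V \<in> W ` {1..n}"
    then obtain j where j: "j \<in> {1..n}" "V = W j" by blast
    with W have "V \<in> M" "\<forall>\<^sub>F x in V. x \<in> P j" by auto
    moreover have "P j \<subseteq> A" using P(1) j(1) by blast
    ultimately show "V \<in> ?S" by (auto elim!: eventually_mono)
  qed
  ultimately have "card {1..n} \<le> card ?S"
    using fin card_image[of W "{1..n}"] card_mono[of ?S "W ` {1..n}"] by simp
  then show False by (simp add: n_def)
qed

section \<open>The corner of the crossed product\<close>

lemma op_eqI: "(\<And>x h. ell2_fun (blinfun_apply S x) h = ell2_fun (blinfun_apply T x) h) \<Longrightarrow> S = T"
  by (intro blinfun_eqI ell2_fun_inject[THEN iffD1] ext)

abbreviation cutoff :: "'a set \<Rightarrow> 'a op" where
  "cutoff E \<equiv> mult_op (indicator E)"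

lemma bounded_range_indicator: "bounded (range (indicator E :: 'a \<Rightarrow> complex))"
  by (rule boundedI[of _ 1]) (auto simp: indicator_def)

lemma cutoff_apply: "ell2_fun (blinfun_apply (cutoff E) x) h = (if h \<in> E then ell2_fun x h else 0)"
  by (simp add: mult_op_apply bounded_range_indicator)

lemma cutoff_comp_cutoff: "cutoff D o\<^sub>L cutoff E = cutoff (D \<inter> E)"
  by (rule op_eqI) (simp add: cutoff_apply)

lemma cutoff_cutoff_apply: "blinfun_apply (cutoff D) (blinfun_apply (cutoff E) x) = blinfun_apply (cutoff (D \<inter> E)) x"
  by (simp flip: cutoff_comp_cutoff)

lemma op_comp_assoc: "(R o\<^sub>L S) o\<^sub>L T = R o\<^sub>L (S o\<^sub>L T)"
  by (rule blinfun_eqI) simp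

lemma cutoff_Un: "D \<inter> E = {} \<Longrightarrow> cutoff (D \<union> E) = cutoff D + cutoff E"
  by (rule op_eqI) (auto simp: cutoff_apply plus_blinfun.rep_eq plus_ell2.rep_eq)

lemma lreg_comp_cutoff: "lreg g o\<^sub>L cutoff E = cutoff (translate g E) o\<^sub>L lreg g"
  by (rule op_eqI) (simp add: cutoff_apply lreg_apply mem_translate)

lemma op_scaleC_comp_left: "op_scaleC c S o\<^sub>L T = op_scaleC c (S o\<^sub>L T)"
  by (rule blinfun_eqI) (simp add: op_scaleC_apply)

lemma reduced_crossed_product_intros:
  shows "bounded (range f) \<Longrightarrow> mult_op f \<in> reduced_crossed_product"
    and "lreg g \<in> reduced_crossed_product"
    and "0 \<in> reduced_crossed_product"
    and "S \<in> reduced_crossed_product \<Longrightarrow> T \<in> reduced_crossed_product \<Longrightarrow> S + T \<in> reduced_crossed_product"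
    and "T \<in> reduced_crossed_product \<Longrightarrow> op_scaleC c T \<in> reduced_crossed_product"
    and "S \<in> reduced_crossed_product \<Longrightarrow> T \<in> reduced_crossed_product \<Longrightarrow> S o\<^sub>L T \<in> reduced_crossed_product"
  unfolding reduced_crossed_product_def cstar_subalgebra_def by auto

text \<open>Compression by the projection \<open>cutoff A\<close> is idempotent, so its image
  consists of its fixed points.\<close>

lemma in_corner_iff:
  "T \<in> corner A \<longleftrightarrow> T \<in> reduced_crossed_product \<and> cutoff A o\<^sub>L T o\<^sub>L cutoff A = T"
proof
  assume "T \<in> corner A"
  then obtain S where S: "S \<in> reduced_crossed_product" "T = cutoff A o\<^sub>L S o\<^sub>L cutoff A"
    unfolding corner_def by auto
  have "cutoff A o\<^sub>L T o\<^sub>L cutoff A = T"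
    unfolding S(2) by (rule blinfun_eqI) (simp add: cutoff_cutoff_apply)
  then show "T \<in> reduced_crossed_product \<and> cutoff A o\<^sub>L T o\<^sub>L cutoff A = T"
    unfolding S(2) using S(1) by (auto intro!: reduced_crossed_product_intros bounded_range_indicator)
next
  assume "T \<in> reduced_crossed_product \<and> cutoff A o\<^sub>L T o\<^sub>L cutoff A = T"
  then show "T \<in> corner A" unfolding corner_def by (metis imageI)
qed

lemma cutoff_comp_corner: "T \<in> corner A \<Longrightarrow> cutoff A o\<^sub>L T = T"
  and corner_comp_cutoff: "T \<in> corner A \<Longrightarrow> T o\<^sub>L cutoff A = T"
  unfolding in_corner_iff by (metis op_comp_assoc cutoff_comp_cutoff inf.idem)+

lemma cutoff_in_corner: "D \<subseteq> A \<Longrightarrow> cutoff D \<in> corner A"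
  unfolding in_corner_iff cutoff_comp_cutoff
  by (auto intro!: reduced_crossed_product_intros bounded_range_indicator simp: Int_absorb1 Int_absorb2)

text \<open>These are the partial isometries that make \<open>cutoff D\<close> and
  \<open>cutoff (translate g D)\<close> equivalent projections inside the corner.\<close>

lemma partial_translation_in_corner:
  assumes "D \<subseteq> A" "translate g D \<subseteq> A"
  shows "lreg g o\<^sub>L cutoff D \<in> corner A"
proof -
  have "cutoff A o\<^sub>L (lreg g o\<^sub>L cutoff D) o\<^sub>L cutoff A = cutoff A o\<^sub>L cutoff (translate g D) o\<^sub>L lreg g o\<^sub>L cutoff A"
    by (simp add: lreg_comp_cutoff op_comp_assoc)
  also have "\<dots> = lreg g o\<^sub>L (cutoff D o\<^sub>L cutoff A)"
    using assms(2) by (simp add: cutoff_comp_cutoff Int_absorb1 flip: lreg_comp_cutoff) (simp add: op_comp_assoc cutoff_comp_cutoff)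
  finally show ?thesis
    using assms(1) unfolding in_corner_iff
    by (auto simp: cutoff_comp_cutoff Int_absorb2 intro!: reduced_crossed_product_intros bounded_range_indicator)
qed

lemma cutoff_empty [simp]: "cutoff {} = 0" "mult_op (\<lambda>_. 0) = 0"
  by (rule op_eqI, simp add: cutoff_apply mult_op_apply zero_blinfun.rep_eq zero_ell2.rep_eq)+

section \<open>Closed ideals of the corner and orthogonal projections modulo them\<close>

lemma closed_ideal_0: "closed_ideal C I \<Longrightarrow> 0 \<in> I"
  and closed_ideal_add: "closed_ideal C I \<Longrightarrow> S \<in> I \<Longrightarrow> T \<in> I \<Longrightarrow> S + T \<in> I"
  and closed_ideal_scaleC: "closed_ideal C I \<Longrightarrow> T \<in> I \<Longrightarrow> op_scaleC c T \<in> I"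
  and closed_ideal_left: "closed_ideal C I \<Longrightarrow> S \<in> C \<Longrightarrow> T \<in> I \<Longrightarrow> S o\<^sub>L T \<in> I"
  and closed_ideal_right: "closed_ideal C I \<Longrightarrow> S \<in> C \<Longrightarrow> T \<in> I \<Longrightarrow> T o\<^sub>L S \<in> I"
  unfolding closed_ideal_def by auto

lemma op_scaleC_minus1: "op_scaleC (- 1) T = - T"
  by (rule op_eqI) (simp add: op_scaleC_apply ell2_scaleC.rep_eq uminus_blinfun.rep_eq uminus_ell2.rep_eq)

lemma closed_ideal_minus: "closed_ideal C I \<Longrightarrow> T \<in> I \<Longrightarrow> - T \<in> I"
  using closed_ideal_scaleC[of C I T "- 1"] by (simp add: op_scaleC_minus1)

lemma closed_ideal_diff: "closed_ideal C I \<Longrightarrow> S \<in> I \<Longrightarrow> T \<in> I \<Longrightarrow> S - T \<in> I"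
  using closed_ideal_add[of C I S "- T"] closed_ideal_minus[of C I T] by simp

lemma closed_ideal_sum:
  "closed_ideal C I \<Longrightarrow> (\<And>i. i \<in> J \<Longrightarrow> f i \<in> I) \<Longrightarrow> (\<Sum>i\<in>J. f i) \<in> I"
  by (induction J rule: infinite_finite_induct) (auto intro: closed_ideal_0 closed_ideal_add)

lemma coset_eqI:
  assumes I: "closed_ideal C I" and d: "S - T \<in> I"
  shows "coset I S = coset I T"
proof -
  have "R \<in> coset I S \<longleftrightarrow> R - S \<in> I" for R S
    unfolding coset_def by (auto intro: image_eqI[of _ _ "R - S"])
  moreover have "R - S \<in> I \<longleftrightarrow> R - T \<in> I" for R
    using closed_ideal_add[OF I _ d, of "R - S"] closed_ideal_diff[OF I _ d, of "R - T"] by auto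
  ultimately show ?thesis by blast
qed

lemma coset_absorb:
  assumes "closed_ideal C I" "T \<in> I"
  shows "coset I T = I"
proof -
  have "coset I T = coset I 0" using assms by (intro coset_eqI) auto
  then show ?thesis by (simp add: coset_def)
qed

text \<open>Sets whose cutoffs lie in \<open>I\<close> are closed under subsets, by multiplication,
  and under disjoint unions, by addition; hence under finite unions.\<close>

lemma cutoff_Union_in_ideal:
  assumes I: "closed_ideal (corner A) I"
    and "finite \<B>" "\<And>B. B \<in> \<B> \<Longrightarrow> cutoff (B \<inter> A) \<in> I"
  shows "cutoff (\<Union>\<B> \<inter> A) \<in> I"
  using assms(2,3)
proof (induction \<B>)
  case empty
  then show ?case using closed_ideal_0[OF I] by simp
next
  case (insert B \<B>)
  let ?D = "\<Union>\<B> \<inter> A" and ?E = "B \<inter> A"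
  have "cutoff (?D - ?E) o\<^sub>L cutoff ?D \<in> I"
    using insert by (intro closed_ideal_left[OF I] cutoff_in_corner) auto
  then have "cutoff (?D - ?E) \<in> I" by (simp only: cutoff_comp_cutoff Int_absorb2[OF Diff_subset])
  moreover have "cutoff ?E \<in> I" using insert by simp
  ultimately have "cutoff (?E \<union> (?D - ?E)) \<in> I"
    by (subst cutoff_Un) (auto intro: closed_ideal_add[OF I])
  moreover have "?E \<union> (?D - ?E) = \<Union>(insert B \<B>) \<inter> A" by blast
  ultimately show ?case by simp
qed

text \<open>\<open>cutoff D\<close> is the conjugate of \<open>cutoff (translate g D)\<close> by the
  partial translation \<open>lreg g o\<^sub>L cutoff D\<close>, whose adjoint is
  \<open>lreg (- g) o\<^sub>L cutoff (translate g D)\<close>.\<close>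

lemma cutoff_translate_in_idealD:
  assumes I: "closed_ideal (corner A) I"
    and D: "D \<subseteq> A" "translate g D \<subseteq> A" "cutoff (translate g D) \<in> I"
  shows "cutoff D \<in> I"
proof -
  have "translate (- g) (translate g D) = D" by (simp add: translate_translate)
  then have "lreg (- g) o\<^sub>L cutoff (translate g D) \<in> corner A" "lreg g o\<^sub>L cutoff D \<in> corner A"
    using D by (auto intro!: partial_translation_in_corner)
  then have "(lreg (- g) o\<^sub>L cutoff (translate g D)) o\<^sub>L cutoff (translate g D) o\<^sub>L (lreg g o\<^sub>L cutoff D) \<in> I"
    by (intro closed_ideal_right[OF I] closed_ideal_left[OF I] D)
  also have "(lreg (- g) o\<^sub>L cutoff (translate g D)) o\<^sub>L cutoff (translate g D) o\<^sub>L (lreg g o\<^sub>L cutoff D) = cutoff D"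
    by (rule op_eqI) (auto simp: cutoff_apply lreg_apply mem_translate)
  finally show ?thesis .
qed

lemma sum_comp_left: "(\<Sum>i\<in>J. f i) o\<^sub>L T = (\<Sum>i\<in>J. f i o\<^sub>L T)"
  by (rule bounded_bilinear.sum_left[OF bounded_bilinear_blinfun_compose])

text \<open>Orthogonal projections outside an ideal are linearly independent modulo it, since
  multiplying a relation by \<open>cutoff (D j)\<close> isolates one term. Representatives of their
  classes are chosen in the span of \<open>B\<close>, so that the dimension bound can be applied to
  operators rather than to cosets.\<close>

lemma card_orthogonal_cuts_le:
  fixes A :: "'a::group_add set"
  assumes I: "closed_ideal (corner A) I"
    and B: "finite B" "quotient (corner A) I = coset I ` module.span op_scaleC B"
    and J: "finite J" "disjoint_family_on D J"
      "\<And>i. i \<in> J \<Longrightarrow> D i \<subseteq> A" "\<And>i. i \<in> J \<Longrightarrow> cutoff (D i) \<notin> I"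
  shows "card J \<le> card B"
proof -
  interpret vs: vector_space "op_scaleC :: complex \<Rightarrow> 'a op \<Rightarrow> 'a op"
    by (rule vector_space_op_scaleC)
  have "\<exists>b\<in>vs.span B. cutoff (D i) - b \<in> I" if "i \<in> J" for i
  proof -
    have "coset I (cutoff (D i)) \<in> quotient (corner A) I"
      unfolding quotient_def using that J(3) by (intro imageI cutoff_in_corner) auto
    then obtain b where b: "b \<in> vs.span B" "coset I (cutoff (D i)) = coset I b"
      using B(2) by auto
    have "cutoff (D i) + 0 \<in> coset I (cutoff (D i))"
      unfolding coset_def using closed_ideal_0[OF I] by (rule imageI)
    then have "cutoff (D i) - b \<in> I" unfolding b(2) by (auto simp: coset_def)
    with b(1) show ?thesis by blast
  qed
  then have "\<forall>i\<in>J. \<exists>b. b \<in> vs.span B \<and> cutoff (D i) - b \<in> I" by blast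
  then obtain b where b: "\<forall>i\<in>J. b i \<in> vs.span B \<and> cutoff (D i) - b i \<in> I"
    by (auto dest!: bchoice)
  have orth: "cutoff (D i) o\<^sub>L cutoff (D j) = (if i = j then cutoff (D j) else 0)" if "i \<in> J" "j \<in> J" for i j
  proof (cases "i = j")
    case False
    then have "D i \<inter> D j = {}" using J(2) that by (auto dest: disjoint_family_onD)
    then show ?thesis using False by (simp add: cutoff_comp_cutoff)
  qed (simp add: cutoff_comp_cutoff)
  \<comment> \<open>A relation between the \<open>b i\<close> is a relation between the
    \<open>cutoff (D i)\<close> modulo \<open>I\<close>.\<close>
  have zero: "c j = 0" if c: "(\<Sum>i\<in>J. op_scaleC (c i) (b i)) = 0" and j: "j \<in> J" for c j
  proof (rule ccontr)
    assume "c j \<noteq> 0"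
    have "(\<Sum>i\<in>J. op_scaleC (c i) (cutoff (D i))) = (\<Sum>i\<in>J. op_scaleC (c i) (cutoff (D i) - b i))"
      using c by (simp add: vs.scale_right_diff_distrib sum_subtractf)
    also have "\<dots> \<in> I"
      using b by (intro closed_ideal_sum[OF I] closed_ideal_scaleC[OF I]) auto
    finally have "(\<Sum>i\<in>J. op_scaleC (c i) (cutoff (D i))) o\<^sub>L cutoff (D j) \<in> I"
      using J(3) j by (intro closed_ideal_right[OF I] cutoff_in_corner)
    also have "(\<Sum>i\<in>J. op_scaleC (c i) (cutoff (D i))) o\<^sub>L cutoff (D j)
        = (\<Sum>i\<in>J. if i = j then op_scaleC (c j) (cutoff (D j)) else 0)"
      unfolding sum_comp_left op_scaleC_comp_left using orth j
      by (intro sum.cong) auto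
    also have "\<dots> = op_scaleC (c j) (cutoff (D j))" using J(1) j by simp
    finally have "op_scaleC (1 / c j) (op_scaleC (c j) (cutoff (D j))) \<in> I"
      by (rule closed_ideal_scaleC[OF I])
    then show False using J(4)[OF j] \<open>c j \<noteq> 0\<close> by simp
  qed
  \<comment> \<open>Independence speaks of the image set only, so coincidences are excluded
    separately: \<open>b i = b j\<close> is a relation with coefficients 1 and -1.\<close>
  have inj: "inj_on b J"
  proof (rule inj_onI, rule ccontr)
    fix i j assume ij: "i \<in> J" "j \<in> J" "b i = b j" "i \<noteq> j"
    define c :: "'b \<Rightarrow> complex" where "c k = (if k = i then 1 else if k = j then - 1 else 0)" for k
    have "(\<Sum>k\<in>J. op_scaleC (c k) (b k)) = (\<Sum>k\<in>{i, j}. op_scaleC (c k) (b k))"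
      using ij J(1) by (intro sum.mono_neutral_right) (auto simp: c_def)
    also have "\<dots> = 0" using ij(3,4) by (simp add: c_def)
    finally have "c i = 0" using ij(1) by (rule zero)
    then show False by (simp add: c_def)
  qed
  have "vs.independent (b ` J)"
  proof (rule vs.independent_if_scalars_zero)
    fix f v assume "(\<Sum>x\<in>b ` J. op_scaleC (f x) x) = 0" and v: "v \<in> b ` J"
    then have "(\<Sum>i\<in>J. op_scaleC (f (b i)) (b i)) = 0" by (simp add: sum.reindex[OF inj])
    then show "f v = 0" using zero[of "\<lambda>i. f (b i)"] v by auto
  qed (use J(1) in simp)
  moreover have "b ` J \<subseteq> vs.span B" using b by auto
  ultimately have "card (b ` J) \<le> card B"
    using vs.independent_span_bound[OF B(1)] by blast
  then show ?thesis by (simp add: card_image[OF inj])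
qed

lemma not_infinitely_divisible_of_findim_quotient:
  fixes A :: "'a::group_add set"
  assumes "A \<noteq> {}" "has_nonzero_findim_quotient (corner A)"
  shows "\<not> infinitely_divisible A"
proof
  assume div: "infinitely_divisible A"
  obtain I B where I: "closed_ideal (corner A) I" "quotient (corner A) I \<noteq> {I}"
      and B: "finite B" "quotient (corner A) I = coset I ` module.span op_scaleC B"
    using assms(2) unfolding has_nonzero_findim_quotient_def by blast
  \<comment> \<open>\<open>cutoff A\<close> is the unit of the corner, so an ideal containing it is
    everything and leaves only the class \<open>I\<close>.\<close>
  have unit: "cutoff A \<notin> I"
  proof
    assume "cutoff A \<in> I"
    then have "T \<in> I" if "T \<in> corner A" for T
      using closed_ideal_left[OF I(1) that] corner_comp_cutoff[OF that] by metis
    then have "quotient (corner A) I \<subseteq> {I}"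
      unfolding quotient_def using coset_absorb[OF I(1)] by auto
    moreover have "quotient (corner A) I \<noteq> {}"
      unfolding quotient_def using cutoff_in_corner[of A A] by blast
    ultimately show False using I(2) by blast
  qed
  \<comment> \<open>\<open>card B\<close> bounds the dimension of the quotient; \<open>n\<close>
    disjoint translates with cutoffs outside \<open>I\<close> are one too many.\<close>
  define n where "n = Suc (card B)"
  have "n_divisible n A" using div by (simp add: infinitely_divisible_def n_def)
  then obtain \<B> where \<B>: "finite \<B>" "\<forall>B\<in>\<B>. spreads n A B" "A \<subseteq> \<Union>\<B>"
    using n_divisible_iff[OF assms(1)] by (auto simp: spread_ideal_def)
  have "\<exists>E\<in>\<B>. cutoff (E \<inter> A) \<notin> I"
  proof (rule ccontr)
    assume "\<not> (\<exists>E\<in>\<B>. cutoff (E \<inter> A) \<notin> I)"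
    then have "cutoff (\<Union>\<B> \<inter> A) \<in> I" by (intro cutoff_Union_in_ideal[OF I(1) \<B>(1)]) auto
    then show False using unit \<B>(3) by (simp add: Int_absorb1)
  qed
  then obtain E where E: "E \<in> \<B>" "cutoff (E \<inter> A) \<notin> I" by blast
  then have "spreads n A (E \<inter> A)" using \<B>(2) spreads_mono by blast
  then obtain s where s: "\<forall>i\<in>{1..n}. translate (s i) (E \<inter> A) \<subseteq> A"
      "disjoint_family_on (\<lambda>i. translate (s i) (E \<inter> A)) {1..n}"
    unfolding spreads_def by auto
  have "card {1..n} \<le> card B"
  proof (rule card_orthogonal_cuts_le[OF I(1) B _ s(2)])
    show "cutoff (translate (s i) (E \<inter> A)) \<notin> I" if "i \<in> {1..n}" for i
      using cutoff_translate_in_idealD[OF I(1) _ _ , of "E \<inter> A" "s i"] E(2) s(1) that by blast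
  qed (use s in auto)
  then show False by (simp add: n_def)
qed

section \<open>Adjoints on square-summable functions\<close>

lift_definition basis_vec :: "'a \<Rightarrow> 'a ell2" is "\<lambda>y i. if i = y then 1 else 0"
  subgoal for y
    by (rule summable_on_cong_neutral[THEN iffD1, OF _ _ _ summable_on_finite[of "{y}"]]) auto
  done

lemma ell2_summable: "(\<lambda>i. (cmod (ell2_fun x i))\<^sup>2) summable_on UNIV"
  using ell2_fun[of x] by simp

lemma ell2_eqI: "(\<And>i. ell2_fun x i = ell2_fun y i) \<Longrightarrow> x = y"
  by (intro ell2_fun_inject[THEN iffD1] ext)

lemma ell2_fun_sum: "ell2_fun (\<Sum>k\<in>F. x k) i = (\<Sum>k\<in>F. ell2_fun (x k) i)"
  by (induction F rule: infinite_finite_induct) (auto simp: zero_ell2.rep_eq plus_ell2.rep_eq)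

lemma norm_ell2_square: "(norm x)\<^sup>2 = (\<Sum>\<^sub>\<infinity>i. (cmod (ell2_fun x i))\<^sup>2)"
  unfolding norm_ell2_def by (simp add: infsum_nonneg)

lemma norm_ell2_finite_support:
  assumes "finite F" "\<And>i. i \<notin> F \<Longrightarrow> ell2_fun x i = 0"
  shows "(norm x)\<^sup>2 = (\<Sum>i\<in>F. (cmod (ell2_fun x i))\<^sup>2)"
  unfolding norm_ell2_square
  by (subst infsum_finite[OF assms(1), symmetric], rule infsum_cong_neutral) (use assms in auto)

lemma norm_basis_vec [simp]: "norm (basis_vec y) = 1"
proof -
  have "(norm (basis_vec y))\<^sup>2 = 1\<^sup>2"
    by (subst norm_ell2_finite_support[of "{y}"]) (auto simp: basis_vec.rep_eq)
  then show ?thesis by (rule power2_eq_imp_eq) auto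
qed

lemma norm_cutoff_split: "(norm x)\<^sup>2 = (norm (blinfun_apply (cutoff E) x))\<^sup>2 + (norm (blinfun_apply (cutoff (- E)) x))\<^sup>2"
proof -
  have "(\<Sum>\<^sub>\<infinity>i. (cmod (ell2_fun x i))\<^sup>2) =
      (\<Sum>\<^sub>\<infinity>i. (cmod (ell2_fun (blinfun_apply (cutoff E) x) i))\<^sup>2 + (cmod (ell2_fun (blinfun_apply (cutoff (- E)) x) i))\<^sup>2)"
    by (rule infsum_cong) (simp add: cutoff_apply)
  also have "\<dots> = (\<Sum>\<^sub>\<infinity>i. (cmod (ell2_fun (blinfun_apply (cutoff E) x) i))\<^sup>2) +
      (\<Sum>\<^sub>\<infinity>i. (cmod (ell2_fun (blinfun_apply (cutoff (- E)) x) i))\<^sup>2)"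
    by (intro infsum_add ell2_summable)
  finally show ?thesis by (simp add: norm_ell2_square)
qed

lemma norm_cutoff_le: "norm (blinfun_apply (cutoff E) x) \<le> norm x"
proof (rule power2_le_imp_le)
  show "(norm (blinfun_apply (cutoff E) x))\<^sup>2 \<le> (norm x)\<^sup>2"
    using norm_cutoff_split[of x E] zero_le_power2[of "norm (blinfun_apply (cutoff (- E)) x)"] by linarith
qed simp

lemma norm_cutoff_mono: "D \<subseteq> E \<Longrightarrow> norm (blinfun_apply (cutoff D) x) \<le> norm (blinfun_apply (cutoff E) x)"
  using norm_cutoff_le[of D "blinfun_apply (cutoff E) x"] by (simp add: cutoff_cutoff_apply Int_absorb2)

lemma norm_ell2_fun_le: "cmod (ell2_fun x i) \<le> norm x"
proof -
  have "(cmod (ell2_fun x i))\<^sup>2 = (norm (blinfun_apply (cutoff {i}) x))\<^sup>2"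
    by (subst norm_ell2_finite_support[of "{i}"]) (auto simp: cutoff_apply)
  then show ?thesis using norm_cutoff_le[of "{i}" x] by simp
qed

lemma cutoff_add_cutoff_compl: "blinfun_apply (cutoff E) x + blinfun_apply (cutoff (- E)) x = x"
  by (rule ell2_eqI) (simp add: plus_ell2.rep_eq cutoff_apply)

lemma cutoff_finite:
  "finite F \<Longrightarrow> blinfun_apply (cutoff F) x = (\<Sum>k\<in>F. ell2_scaleC (ell2_fun x k) (basis_vec k))"
  by (rule ell2_eqI)
    (simp add: cutoff_apply ell2_fun_sum ell2_scaleC.rep_eq basis_vec.rep_eq if_distrib cong: if_cong)

lemma cinner_basis_vec: "cinner x (basis_vec i) = ell2_fun x i"
proof -
  have "cinner x (basis_vec i) = (\<Sum>\<^sub>\<infinity>j\<in>{i}. ell2_fun x j)"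
    unfolding cinner.rep_eq by (rule infsum_cong_neutral) (auto simp: basis_vec.rep_eq)
  then show ?thesis by simp
qed

lemma cinner_add_right: "cinner z (x + y) = cinner z x + cinner z y"
  by (subst (1 2 3) cinner_commute) (simp add: cinner_add_left)

lemma cinner_scaleC_right: "cinner z (ell2_scaleC c x) = cnj c * cinner z x"
  by (subst (1 2) cinner_commute) (simp add: cinner_scaleC_left)

lemma cinner_zero_left [simp]: "cinner 0 z = 0"
  by transfer simp

lemma cinner_zero_right [simp]: "cinner z 0 = 0"
  by transfer simp

lemma cinner_sum_left: "cinner (\<Sum>k\<in>F. x k) z = (\<Sum>k\<in>F. cinner (x k) z)"
  by (induction F rule: infinite_finite_induct) (auto simp: cinner_add_left)

lemma cinner_sum_right: "cinner z (\<Sum>k\<in>F. x k) = (\<Sum>k\<in>F. cinner z (x k))"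
  by (induction F rule: infinite_finite_induct) (auto simp: cinner_add_right)

text \<open>The real inner product sees only the real part. Rotating \<open>x\<close> by the phase
  \<open>c\<close> makes the complex one real and non-negative, and the real Cauchy-Schwarz
  inequality applies.\<close>

lemma cmod_cinner_le: "cmod (cinner x y) \<le> norm x * norm y"
proof (cases "cinner x y = 0")
  case False
  define c where "c = cnj (sgn (cinner x y))"
  have "c * cinner x y = complex_of_real (cmod (cinner x y))"
    using False by (simp add: c_def sgn_div_norm complex_norm_square[symmetric] power2_eq_square
        field_simps scaleR_conv_of_real)
  then have "cmod (cinner x y) = inner (ell2_scaleC c x) y"
    by (simp add: inner_ell2_def cinner_scaleC_left)
  also have "\<dots> \<le> norm (ell2_scaleC c x) * norm y" by (rule norm_cauchy_schwarz)
  finally show ?thesis using False by (simp add: norm_ell2_scaleC c_def norm_sgn)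
qed simp

text \<open>By Pythagoras the squared error is \<open>(norm x)\<^sup>2\<close> minus a partial sum
  of the series for \<open>(norm x)\<^sup>2\<close>.\<close>

lemma cutoff_tendsto: "((\<lambda>F. blinfun_apply (cutoff F) x) \<longlongrightarrow> x) (finite_subsets_at_top UNIV)"
proof -
  have "((\<lambda>F. \<Sum>i\<in>F. (cmod (ell2_fun x i))\<^sup>2) \<longlongrightarrow> (norm x)\<^sup>2) (finite_subsets_at_top UNIV)"
    using has_sum_infsum[OF ell2_summable[of x]] by (simp add: has_sum_def norm_ell2_square)
  then have "((\<lambda>F. (norm x)\<^sup>2 - (\<Sum>i\<in>F. (cmod (ell2_fun x i))\<^sup>2)) \<longlongrightarrow> (norm x)\<^sup>2 - (norm x)\<^sup>2)
      (finite_subsets_at_top UNIV)"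
    by (intro tendsto_diff tendsto_const)
  moreover have "\<forall>\<^sub>F F in finite_subsets_at_top UNIV.
      (norm x)\<^sup>2 - (\<Sum>i\<in>F. (cmod (ell2_fun x i))\<^sup>2) = (norm (blinfun_apply (cutoff F) x - x))\<^sup>2"
  proof (rule eventually_finite_subsets_at_top_weakI)
    fix F :: "'a set" assume F: "finite F"
    have "blinfun_apply (cutoff F) x - x = - blinfun_apply (cutoff (- F)) x"
      using cutoff_add_cutoff_compl[of F x] by (metis add_diff_cancel_left' minus_diff_eq)
    then have "norm (blinfun_apply (cutoff F) x - x) = norm (blinfun_apply (cutoff (- F)) x)"
      by (metis norm_minus_cancel)
    moreover have "(norm (blinfun_apply (cutoff F) x))\<^sup>2 = (\<Sum>i\<in>F. (cmod (ell2_fun x i))\<^sup>2)"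
      by (subst norm_ell2_finite_support[OF F]) (auto simp: cutoff_apply)
    ultimately show "(norm x)\<^sup>2 - (\<Sum>i\<in>F. (cmod (ell2_fun x i))\<^sup>2) = (norm (blinfun_apply (cutoff F) x - x))\<^sup>2"
      using norm_cutoff_split[of x F] by (metis add_diff_cancel_left')
  qed
  ultimately have "((\<lambda>F. (norm (blinfun_apply (cutoff F) x - x))\<^sup>2) \<longlongrightarrow> 0) (finite_subsets_at_top UNIV)"
    by (simp add: tendsto_cong)
  then have "((\<lambda>F. norm (blinfun_apply (cutoff F) x - x)) \<longlongrightarrow> 0) (finite_subsets_at_top UNIV)"
    by (simp add: tendsto_null_power)
  then show ?thesis by (simp add: LIM_zero_iff tendsto_norm_zero_iff)
qed

section \<open>Norms and existence of adjoints\<close>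

lemma is_adjoint_sym: "is_adjoint T S \<Longrightarrow> is_adjoint S T"
  unfolding is_adjoint_def by (metis cinner_commute)

text \<open>The squared norm of \<open>S y\<close> equals \<open>cinner (T (S y)) y\<close>. Applied
  to differences, the bound lets norm approximations pass to adjoints.\<close>

lemma norm_adjoint_le:
  assumes "is_adjoint T S"
  shows "norm S \<le> norm T"
proof (rule norm_blinfun_bound)
  fix y
  let ?z = "blinfun_apply S y"
  have "complex_of_real ((norm ?z)\<^sup>2) = cinner ?z ?z"
    by (simp add: cinner_self norm_ell2_square)
  also have "\<dots> = cinner (blinfun_apply T ?z) y"
    using assms by (simp add: is_adjoint_def)
  finally have "(norm ?z)\<^sup>2 = cmod (cinner (blinfun_apply T ?z) y)"
    by (metis abs_of_nonneg norm_of_real zero_le_power2)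
  also have "\<dots> \<le> norm (blinfun_apply T ?z) * norm y" by (rule cmod_cinner_le)
  also have "\<dots> \<le> norm T * norm ?z * norm y"
    by (intro mult_right_mono norm_blinfun) auto
  finally have "norm ?z * norm ?z \<le> norm ?z * (norm T * norm y)"
    by (simp add: power2_eq_square mult_ac)
  then show "norm ?z \<le> norm T * norm y"
    by (cases "norm ?z = 0") (auto simp: mult_le_cancel_left)
qed simp

lemma B_ell2_scaleC: "T \<in> B_ell2 \<Longrightarrow> blinfun_apply T (ell2_scaleC c x) = ell2_scaleC c (blinfun_apply T x)"
  by (simp add: B_ell2_def)

text \<open>For the finitely supported vector \<open>z\<close> formed from these coefficients,
  \<open>cinner y (T z)\<close> equals \<open>(norm z)\<^sup>2\<close>; Cauchy-Schwarz and division
  by \<open>norm z\<close> give the bound.\<close>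

lemma adjoint_coeffs_sum_le:
  assumes T: "T \<in> B_ell2" and F: "finite F"
  shows "(\<Sum>i\<in>F. (cmod (cinner y (blinfun_apply T (basis_vec i))))\<^sup>2) \<le> (norm T * norm y)\<^sup>2"
proof -
  define f where "f i = cinner y (blinfun_apply T (basis_vec i))" for i
  define z where "z = (\<Sum>i\<in>F. ell2_scaleC (f i) (basis_vec i))"
  define s where "s = (\<Sum>i\<in>F. (cmod (f i))\<^sup>2)"
  have "ell2_fun z i = (if i \<in> F then f i else 0)" for i
    using F by (simp add: z_def ell2_fun_sum ell2_scaleC.rep_eq basis_vec.rep_eq if_distrib cong: if_cong)
  then have nz: "(norm z)\<^sup>2 = s"
    by (subst norm_ell2_finite_support[OF F]) (auto simp: s_def)
  have "cinner y (blinfun_apply T z) = (\<Sum>i\<in>F. cnj (f i) * f i)"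
    by (simp add: z_def blinfun.sum_right B_ell2_scaleC[OF T] cinner_sum_right cinner_scaleC_right f_def)
  also have "\<dots> = complex_of_real s"
    by (simp add: s_def complex_norm_square mult.commute del: of_real_power)
  finally have "cmod (cinner y (blinfun_apply T z)) = \<bar>s\<bar>" by simp
  then have "s = cmod (cinner y (blinfun_apply T z))"
    using sum_nonneg[of F "\<lambda>i. (cmod (f i))\<^sup>2"] by (simp add: s_def)
  also have "\<dots> \<le> norm y * norm (blinfun_apply T z)" by (rule cmod_cinner_le)
  also have "\<dots> \<le> norm y * (norm T * norm z)" by (intro mult_left_mono norm_blinfun) auto
  finally have "norm z * norm z \<le> norm z * (norm T * norm y)"
    using nz by (simp add: power2_eq_square mult_ac)
  then have "norm z \<le> norm T * norm y"
    by (cases "norm z = 0") (auto simp: mult_le_cancel_left)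
  then have "(norm z)\<^sup>2 \<le> (norm T * norm y)\<^sup>2" by (intro power_mono) auto
  then show ?thesis by (simp add: nz s_def f_def)
qed

text \<open>The coordinates of the adjoint at \<open>y\<close> are forced to be
  \<open>cinner y (T (basis_vec i))\<close>, and the uniform bound on finite sums makes them
  square-summable. The adjoint identity holds on basis vectors, hence on finitely supported vectors,
  hence everywhere by continuity.\<close>

lemma adjoint_exists:
  assumes T: "T \<in> B_ell2"
  shows "\<exists>S\<in>B_ell2. is_adjoint T S"
proof -
  define f where "f y i = cinner y (blinfun_apply T (basis_vec i))" for y i
  have bound: "(\<Sum>i\<in>F. (cmod (f y i))\<^sup>2) \<le> (norm T * norm y)\<^sup>2" if "finite F" for F y
    unfolding f_def using adjoint_coeffs_sum_le[OF T that] .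
  have sm: "(\<lambda>i. (cmod (f y i))\<^sup>2) summable_on UNIV" for y
    by (rule nonneg_bdd_above_summable_on) (auto intro!: bdd_aboveI2 bound)
  define L where "L y = Abs_ell2 (f y)" for y
  have L: "ell2_fun (L y) = f y" for y
    unfolding L_def using sm by (subst Abs_ell2_inverse) auto
  have "bounded_linear L"
  proof (rule bounded_linear_intro[where K = "norm T"])
    fix x y :: "'a ell2" and r :: real
    show "L (x + y) = L x + L y"
      by (rule ell2_eqI) (simp add: L plus_ell2.rep_eq f_def cinner_add_left)
    show "L (r *\<^sub>R x) = r *\<^sub>R L x"
      by (rule ell2_eqI) (simp add: L scaleR_ell2.rep_eq f_def cinner_scaleR_left)
    have "(norm (L x))\<^sup>2 \<le> (norm T * norm x)\<^sup>2"
      unfolding norm_ell2_square L by (intro infsum_le_finite_sums sm) (rule bound)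
    then have "norm (L x) \<le> norm T * norm x" by (rule power2_le_imp_le) simp
    then show "norm (L x) \<le> norm x * norm T" by (simp add: mult.commute)
  qed
  then have S: "blinfun_apply (Blinfun L) = L" by (rule bounded_linear_Blinfun_apply)
  have basis: "cinner (blinfun_apply T (basis_vec i)) y = cinner (basis_vec i) (L y)" for i y
    by (subst (1 2) cinner_commute) (simp add: cinner_basis_vec L f_def)
  have "cinner (blinfun_apply T x) y = cinner x (L y)" for x y
  proof (rule tendsto_unique)
    let ?F = "finite_subsets_at_top (UNIV :: 'a set)"
    have bl: "bounded_linear (\<lambda>x. cinner x z)" for z :: "'a ell2"
      by (rule bounded_linear_intro[where K = "norm z"])
        (auto simp: cinner_add_left cinner_scaleR_left scaleR_conv_of_real cmod_cinner_le)
    show "((\<lambda>F. cinner (blinfun_apply T (blinfun_apply (cutoff F) x)) y) \<longlongrightarrow> cinner (blinfun_apply T x) y) ?F"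
      by (intro bounded_linear.tendsto[OF bl] blinfun.tendsto tendsto_const cutoff_tendsto)
    have "cinner (blinfun_apply T (blinfun_apply (cutoff F) x)) y = cinner (blinfun_apply (cutoff F) x) (L y)"
      if "finite F" for F
      by (simp add: cutoff_finite[OF that] blinfun.sum_right B_ell2_scaleC[OF T] cinner_sum_left
          cinner_scaleC_left basis)
    then have "\<forall>\<^sub>F F in ?F. cinner (blinfun_apply (cutoff F) x) (L y) =
        cinner (blinfun_apply T (blinfun_apply (cutoff F) x)) y"
      by (intro eventually_finite_subsets_at_top_weakI) auto
    moreover have "((\<lambda>F. cinner (blinfun_apply (cutoff F) x) (L y)) \<longlongrightarrow> cinner x (L y)) ?F"
      by (intro bounded_linear.tendsto[OF bl] cutoff_tendsto)
    ultimately show "((\<lambda>F. cinner (blinfun_apply T (blinfun_apply (cutoff F) x)) y) \<longlongrightarrow> cinner x (L y)) ?F"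
      by (rule Lim_transform_eventually[rotated])
  qed simp
  then have "is_adjoint T (Blinfun L)" by (simp add: is_adjoint_def S)
  moreover have "Blinfun L \<in> B_ell2"
    unfolding B_ell2_def by (auto intro!: ell2_eqI simp: S L f_def ell2_scaleC.rep_eq cinner_scaleC_left)
  ultimately show ?thesis by blast
qed

section \<open>The uniform Roe algebra\<close>

text \<open>The translate is on the right because \<open>lreg g\<close> sends
  \<open>basis_vec y\<close> to \<open>basis_vec (g + y)\<close>: its column at \<open>y\<close>
  lives on \<open>{g} + y\<close>.\<close>

definition right_translate :: "'a::group_add set \<Rightarrow> 'a \<Rightarrow> 'a set" where
  "right_translate F y = (\<lambda>k. k + y) ` F"

lemma finite_right_translate [simp]: "finite F \<Longrightarrow> finite (right_translate F y)"
  by (simp add: right_translate_def)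

lemma right_translate_mono: "F \<subseteq> F' \<Longrightarrow> right_translate F y \<subseteq> right_translate F' y"
  by (auto simp: right_translate_def)

text \<open>
  The columns of \<open>T\<close> are, uniformly, approximately supported in a finite translate of the diagonal.
  The operators which satisfy this together with their adjoints form the uniform Roe algebra, which
  is all that is needed to know about the operators in the reduced crossed product.
\<close>

definition column_finite :: "'a::group_add op \<Rightarrow> bool" where
  "column_finite T \<longleftrightarrow> (\<forall>e>0. \<exists>F. finite F \<and>
     (\<forall>y. norm (blinfun_apply (cutoff (- right_translate F y)) (blinfun_apply T (basis_vec y))) < e))"

definition roe_algebra :: "'a::group_add op set" where
  "roe_algebra = {T \<in> B_ell2. column_finite T \<and> (\<exists>S\<in>B_ell2. is_adjoint T S \<and> column_finite S)}"

lemma column_finiteE: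
  assumes "column_finite T" "e > 0"
  obtains F where "finite F"
    "\<And>y. norm (blinfun_apply (cutoff (- right_translate F y)) (blinfun_apply T (basis_vec y))) < e"
  using assms unfolding column_finite_def by auto

lemma column_finite_mono:
  assumes "norm (blinfun_apply (cutoff (- right_translate F y)) v) < e" "F \<subseteq> F'"
  shows "norm (blinfun_apply (cutoff (- right_translate F' y)) v) < e"
proof -
  have "- right_translate F' y \<subseteq> - right_translate F y"
    using right_translate_mono[OF assms(2)] by blast
  then show ?thesis using norm_cutoff_mono assms(1) by (meson le_less_trans)
qed

lemma column_finite_exact:
  assumes "finite F" "\<And>y z. z \<notin> right_translate F y \<Longrightarrow> ell2_fun (blinfun_apply T (basis_vec y)) z = 0"
  shows "column_finite T"
proof -
  have "blinfun_apply (cutoff (- right_translate F y)) (blinfun_apply T (basis_vec y)) = 0" for y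
    by (rule ell2_eqI) (simp add: cutoff_apply zero_ell2.rep_eq assms(2))
  then show ?thesis unfolding column_finite_def using assms(1) by (auto intro!: exI[of _ F])
qed

lemma column_finite_approx:
  assumes "\<And>e. e > 0 \<Longrightarrow> \<exists>S. column_finite S \<and> norm (T - S) < e"
  shows "column_finite T"
  unfolding column_finite_def
proof (intro allI impI)
  fix e :: real assume "e > 0"
  then obtain S where S: "column_finite S" "norm (T - S) < e / 2" using assms[of "e / 2"] by auto
  obtain F where F: "finite F"
    "\<And>y. norm (blinfun_apply (cutoff (- right_translate F y)) (blinfun_apply S (basis_vec y))) < e / 2"
    using column_finiteE[OF S(1), of "e / 2"] \<open>e > 0\<close> by auto
  have "norm (blinfun_apply (cutoff (- right_translate F y)) (blinfun_apply T (basis_vec y))) < e" for y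
  proof -
    let ?P = "cutoff (- right_translate F y)"
    have "blinfun_apply T (basis_vec y) = blinfun_apply S (basis_vec y) + blinfun_apply (T - S) (basis_vec y)"
      by (simp add: minus_blinfun.rep_eq)
    then have "norm (blinfun_apply ?P (blinfun_apply T (basis_vec y))) \<le>
        norm (blinfun_apply ?P (blinfun_apply S (basis_vec y)))
        + norm (blinfun_apply ?P (blinfun_apply (T - S) (basis_vec y)))"
      by (simp only: blinfun.add_right norm_triangle_ineq)
    moreover have "norm (blinfun_apply ?P (blinfun_apply (T - S) (basis_vec y))) \<le> norm (T - S)"
      using norm_cutoff_le[of "- right_translate F y" "blinfun_apply (T - S) (basis_vec y)"]
        norm_blinfun[of "T - S" "basis_vec y"] by simp
    ultimately show ?thesis using F(2)[of y] S(2) by linarith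
  qed
  with F(1) show "\<exists>F. finite F \<and>
     (\<forall>y. norm (blinfun_apply (cutoff (- right_translate F y)) (blinfun_apply T (basis_vec y))) < e)"
    by blast
qed

lemma column_finite_add:
  assumes "column_finite S" "column_finite T"
  shows "column_finite (S + T)"
  unfolding column_finite_def
proof (intro allI impI)
  fix e :: real assume "e > 0"
  then have e: "e / 2 > 0" by simp
  obtain F1 where F1: "finite F1"
    "\<And>y. norm (blinfun_apply (cutoff (- right_translate F1 y)) (blinfun_apply S (basis_vec y))) < e / 2"
    using column_finiteE[OF assms(1) e] by blast
  obtain F2 where F2: "finite F2"
    "\<And>y. norm (blinfun_apply (cutoff (- right_translate F2 y)) (blinfun_apply T (basis_vec y))) < e / 2"
    using column_finiteE[OF assms(2) e] by blast
  have "norm (blinfun_apply (cutoff (- right_translate (F1 \<union> F2) y)) (blinfun_apply (S + T) (basis_vec y))) < e" for y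
  proof -
    let ?P = "cutoff (- right_translate (F1 \<union> F2) y)"
    have "norm (blinfun_apply ?P (blinfun_apply (S + T) (basis_vec y))) \<le>
        norm (blinfun_apply ?P (blinfun_apply S (basis_vec y)))
        + norm (blinfun_apply ?P (blinfun_apply T (basis_vec y)))"
      by (simp only: plus_blinfun.rep_eq blinfun.add_right norm_triangle_ineq)
    moreover have "norm (blinfun_apply ?P (blinfun_apply S (basis_vec y))) < e / 2"
      by (rule column_finite_mono[OF F1(2)]) simp
    moreover have "norm (blinfun_apply ?P (blinfun_apply T (basis_vec y))) < e / 2"
      by (rule column_finite_mono[OF F2(2)]) simp
    ultimately show ?thesis by linarith
  qed
  with F1(1) F2(1) show "\<exists>F. finite F \<and>
     (\<forall>y. norm (blinfun_apply (cutoff (- right_translate F y)) (blinfun_apply (S + T) (basis_vec y))) < e)"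
    by (intro exI[of _ "F1 \<union> F2"]) auto
qed

lemma ell2_scaleC_cutoff: "blinfun_apply (cutoff E) (ell2_scaleC c x) = ell2_scaleC c (blinfun_apply (cutoff E) x)"
  by (rule ell2_eqI) (simp add: cutoff_apply ell2_scaleC.rep_eq)

lemma column_finite_scaleC:
  assumes "column_finite T"
  shows "column_finite (op_scaleC c T)"
  unfolding column_finite_def
proof (intro allI impI)
  fix e :: real assume "e > 0"
  \<comment> \<open>The summand 1 guards against \<open>c = 0\<close>.\<close>
  then have e: "e / (cmod c + 1) > 0" by (intro divide_pos_pos) (auto intro: add_nonneg_pos)
  obtain F where F: "finite F"
    "\<And>y. norm (blinfun_apply (cutoff (- right_translate F y)) (blinfun_apply T (basis_vec y))) < e / (cmod c + 1)"
    using column_finiteE[OF assms e] by blast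
  have "norm (blinfun_apply (cutoff (- right_translate F y)) (blinfun_apply (op_scaleC c T) (basis_vec y))) < e" for y
  proof -
    let ?n = "norm (blinfun_apply (cutoff (- right_translate F y)) (blinfun_apply T (basis_vec y)))"
    have "cmod c * ?n \<le> (cmod c + 1) * ?n" by (intro mult_right_mono) auto
    also have "\<dots> < (cmod c + 1) * (e / (cmod c + 1))"
      using F(2)[of y] by (intro mult_strict_left_mono) (auto intro: add_nonneg_pos)
    also have "\<dots> = e" using norm_ge_zero[of c] by (simp add: field_simps add_nonneg_eq_0_iff)
    finally show ?thesis by (simp add: op_scaleC_apply ell2_scaleC_cutoff norm_ell2_scaleC)
  qed
  with F(1) show "\<exists>F. finite F \<and>
     (\<forall>y. norm (blinfun_apply (cutoff (- right_translate F y)) (blinfun_apply (op_scaleC c T) (basis_vec y))) < e)"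
    by blast
qed

lemma column_decomposition:
  fixes F :: "'a::group_add set"
  assumes "finite F"
  shows "x = (\<Sum>k\<in>F. ell2_scaleC (ell2_fun x (k + y)) (basis_vec (k + y))) +
    blinfun_apply (cutoff (- right_translate F y)) x"
proof -
  have inj: "inj_on (\<lambda>k. k + y) F" by (rule inj_onI) simp
  have "blinfun_apply (cutoff (right_translate F y)) x =
      (\<Sum>k\<in>F. ell2_scaleC (ell2_fun x (k + y)) (basis_vec (k + y)))"
    unfolding cutoff_finite[OF finite_right_translate[OF assms]]
    by (simp add: right_translate_def sum.reindex[OF inj])
  then show ?thesis using cutoff_add_cutoff_compl[of "right_translate F y" x] by simp
qed

lemma norm_column_le: "norm (blinfun_apply T (basis_vec y)) \<le> norm T"
  using norm_blinfun[of T "basis_vec y"] by simp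

text \<open>Up to a small tail, the column of \<open>T\<close> at \<open>y\<close> combines the
  vectors \<open>basis_vec (k + y)\<close> with \<open>k\<close> in \<open>F1\<close>, and
  \<open>S\<close> moves each of them essentially into \<open>F2 + (k + y)\<close>. So the product
  is supported near \<open>F2 + F1\<close>.\<close>

lemma column_finite_comp:
  fixes S T :: "'a::group_add op"
  assumes S: "S \<in> B_ell2" "column_finite S" and T: "column_finite T"
  shows "column_finite (S o\<^sub>L T)"
  unfolding column_finite_def
proof (intro allI impI)
  fix e :: real assume "e > 0"
  define e1 where "e1 = e / (2 * (norm S + 1))"
  have e1: "e1 > 0" using \<open>e > 0\<close> norm_ge_zero[of S] by (simp add: e1_def add_nonneg_pos)
  obtain F1 where F1: "finite F1"
    "\<And>y. norm (blinfun_apply (cutoff (- right_translate F1 y)) (blinfun_apply T (basis_vec y))) < e1"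
    using column_finiteE[OF T e1] by blast
  define m where "m = real (card F1)"
  \<comment> \<open>\<open>F2\<close> has to be chosen after \<open>F1\<close>: the errors of
    \<open>m\<close> columns of \<open>S\<close> add up, each weighted by an entry of
    \<open>T\<close> of size at most \<open>norm T\<close>.\<close>
  define e2 where "e2 = e / (2 * ((m + 1) * (norm T + 1)))"
  have m: "m \<ge> 0" by (simp add: m_def)
  have e2: "e2 > 0" using \<open>e > 0\<close> norm_ge_zero[of T] m by (simp add: e2_def add_nonneg_pos)
  obtain F2 where F2: "finite F2"
    "\<And>y. norm (blinfun_apply (cutoff (- right_translate F2 y)) (blinfun_apply S (basis_vec y))) < e2"
    using column_finiteE[OF S(2) e2] by blast
  define F where "F = (\<lambda>(a, b). a + b) ` (F2 \<times> F1)"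
  have "norm (blinfun_apply (cutoff (- right_translate F y)) (blinfun_apply (S o\<^sub>L T) (basis_vec y))) < e" for y
  proof -
    let ?P = "cutoff (- right_translate F y)" and ?t = "blinfun_apply T (basis_vec y)"
    let ?w = "blinfun_apply (cutoff (- right_translate F1 y)) ?t"
    define c where "c k = ell2_fun ?t (k + y)" for k
    have c: "cmod (c k) \<le> norm T" for k
      unfolding c_def using norm_ell2_fun_le norm_column_le by (rule order_trans)
    have "?t = (\<Sum>k\<in>F1. ell2_scaleC (c k) (basis_vec (k + y))) + ?w"
      unfolding c_def by (rule column_decomposition[OF F1(1)])
    then have "blinfun_apply ?P (blinfun_apply (S o\<^sub>L T) (basis_vec y)) =
        blinfun_apply ?P (blinfun_apply S ((\<Sum>k\<in>F1. ell2_scaleC (c k) (basis_vec (k + y))) + ?w))"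
      by simp
    also have "\<dots> = (\<Sum>k\<in>F1. ell2_scaleC (c k) (blinfun_apply ?P (blinfun_apply S (basis_vec (k + y)))))
        + blinfun_apply ?P (blinfun_apply S ?w)"
      by (simp only: blinfun.add_right blinfun.sum_right B_ell2_scaleC[OF S(1)] ell2_scaleC_cutoff)
    finally have "norm (blinfun_apply ?P (blinfun_apply (S o\<^sub>L T) (basis_vec y))) \<le>
        norm (\<Sum>k\<in>F1. ell2_scaleC (c k) (blinfun_apply ?P (blinfun_apply S (basis_vec (k + y)))))
        + norm (blinfun_apply ?P (blinfun_apply S ?w))"
      by (simp only: norm_triangle_ineq)
    moreover have "norm (\<Sum>k\<in>F1. ell2_scaleC (c k) (blinfun_apply ?P (blinfun_apply S (basis_vec (k + y))))) < e / 2"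
    proof -
      have col: "norm (blinfun_apply ?P (blinfun_apply S (basis_vec (k + y)))) \<le> e2" if k: "k \<in> F1" for k
      proof -
        have "right_translate F2 (k + y) \<subseteq> right_translate F y"
        proof
          fix z assume "z \<in> right_translate F2 (k + y)"
          then obtain a where a: "a \<in> F2" "z = a + (k + y)" by (auto simp: right_translate_def)
          then have "z = (a + k) + y" by (simp add: add.assoc)
          moreover have "a + k \<in> F" using a(1) k by (auto simp: F_def)
          ultimately show "z \<in> right_translate F y" by (auto simp: right_translate_def)
        qed
        then have "- right_translate F y \<subseteq> - right_translate F2 (k + y)" by blast
        then have "norm (blinfun_apply ?P (blinfun_apply S (basis_vec (k + y)))) \<le>
          norm (blinfun_apply (cutoff (- right_translate F2 (k + y))) (blinfun_apply S (basis_vec (k + y))))"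
          by (rule norm_cutoff_mono)
        then show ?thesis using F2(2)[of "k + y"] by linarith
      qed
      have "norm (\<Sum>k\<in>F1. ell2_scaleC (c k) (blinfun_apply ?P (blinfun_apply S (basis_vec (k + y)))))
          \<le> (\<Sum>k\<in>F1. norm T * e2)"
        by (rule sum_norm_le) (auto simp: norm_ell2_scaleC intro!: mult_mono c col)
      also have "\<dots> = m * norm T * e2" by (simp add: m_def)
      also have "\<dots> < (m + 1) * (norm T + 1) * e2"
      proof (rule mult_strict_right_mono[OF _ e2])
        have "(m + 1) * (norm T + 1) = m * norm T + (m + norm T + 1)" by (simp add: algebra_simps)
        then show "m * norm T < (m + 1) * (norm T + 1)" using m norm_ge_zero[of T] by linarith
      qed
      also have "\<dots> = e / 2"
        using m norm_ge_zero[of T] by (simp add: e2_def field_simps add_nonneg_eq_0_iff)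
      finally show ?thesis .
    qed
    moreover have "norm (blinfun_apply ?P (blinfun_apply S ?w)) < e / 2"
    proof -
      have "norm (blinfun_apply ?P (blinfun_apply S ?w)) \<le> norm S * norm ?w"
        using norm_cutoff_le norm_blinfun by (rule order_trans)
      also have "\<dots> \<le> norm S * e1"
        using F1(2)[of y] by (intro mult_left_mono) auto
      also have "\<dots> < (norm S + 1) * e1" using e1 by (simp add: algebra_simps)
      also have "\<dots> = e / 2"
        using norm_ge_zero[of S] by (simp add: e1_def field_simps add_nonneg_eq_0_iff)
      finally show ?thesis .
    qed
    ultimately show ?thesis by linarith
  qed
  moreover have "finite F" using F1(1) F2(1) by (simp add: F_def)
  ultimately show "\<exists>F. finite F \<and>
     (\<forall>y. norm (blinfun_apply (cutoff (- right_translate F y)) (blinfun_apply (S o\<^sub>L T) (basis_vec y))) < e)"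
    by blast
qed

lemma is_adjoint_add: "is_adjoint T S \<Longrightarrow> is_adjoint T' S' \<Longrightarrow> is_adjoint (T + T') (S + S')"
  by (simp add: is_adjoint_def plus_blinfun.rep_eq cinner_add_left cinner_add_right)

lemma is_adjoint_scaleC: "is_adjoint T S \<Longrightarrow> is_adjoint (op_scaleC c T) (op_scaleC (cnj c) S)"
  by (simp add: is_adjoint_def op_scaleC_apply cinner_scaleC_left cinner_scaleC_right)

lemma is_adjoint_comp: "is_adjoint T S \<Longrightarrow> is_adjoint T' S' \<Longrightarrow> is_adjoint (T o\<^sub>L T') (S' o\<^sub>L S)"
  by (simp add: is_adjoint_def)

lemma is_adjoint_diff: "is_adjoint T S \<Longrightarrow> is_adjoint T' S' \<Longrightarrow> is_adjoint (T - T') (S - S')"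
  using is_adjoint_add[of T S "op_scaleC (- 1) T'" "op_scaleC (- 1) S'"] is_adjoint_scaleC[of T' S' "- 1"]
  by (simp add: op_scaleC_minus1)

lemma B_ell2_add: "S \<in> B_ell2 \<Longrightarrow> T \<in> B_ell2 \<Longrightarrow> S + T \<in> B_ell2"
  by (auto simp: B_ell2_def plus_blinfun.rep_eq plus_ell2.rep_eq ell2_scaleC.rep_eq algebra_simps intro!: ell2_eqI)

lemma B_ell2_op_scaleC: "T \<in> B_ell2 \<Longrightarrow> op_scaleC c T \<in> B_ell2"
  by (auto simp: B_ell2_def op_scaleC_apply ell2_scaleC.rep_eq algebra_simps intro!: ell2_eqI)

lemma B_ell2_comp: "S \<in> B_ell2 \<Longrightarrow> T \<in> B_ell2 \<Longrightarrow> S o\<^sub>L T \<in> B_ell2"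
  by (simp add: B_ell2_def)

lemma closed_B_ell2: "closed (B_ell2 :: 'a op set)"
proof -
  have eq: "B_ell2 = (\<Inter>c. \<Inter>x. {T :: 'a op. blinfun_apply T (ell2_scaleC c x) = ell2_scaleC c (blinfun_apply T x)})"
    by (auto simp: B_ell2_def)
  show ?thesis
    unfolding eq
    by (intro closed_INT ballI closed_Collect_eq continuous_intros
        bounded_linear.continuous_on[OF bounded_linear_ell2_scaleC])
qed

text \<open>A limit operator has some adjoint by \<open>adjoint_exists\<close>. It is column-finite
  because \<open>norm_adjoint_le\<close> makes the adjoints of the approximants converge to
  it.\<close>

lemma closed_roe_algebra: "closed (roe_algebra :: 'a::group_add op set)"
proof -
  have "T \<in> roe_algebra" if "T \<in> closure roe_algebra" for T :: "'a op"
  proof -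
    have approx: "\<exists>T'\<in>roe_algebra. norm (T - T') < e" if "e > 0" for e
      using \<open>T \<in> closure roe_algebra\<close> that unfolding closure_approachable
      by (metis dist_norm norm_minus_commute)
    have "(roe_algebra :: 'a op set) \<subseteq> B_ell2" by (auto simp: roe_algebra_def)
    then have T: "T \<in> B_ell2"
      using closure_minimal[OF _ closed_B_ell2] that by blast
    obtain S where S: "S \<in> B_ell2" "is_adjoint T S" using adjoint_exists[OF T] by blast
    have "column_finite T"
      using approx by (intro column_finite_approx) (auto simp: roe_algebra_def)
    moreover have "column_finite S"
    proof (rule column_finite_approx)
      fix e :: real assume "e > 0"
      with approx obtain T' where T': "T' \<in> roe_algebra" "norm (T - T') < e" by blast
      then obtain S' where S': "is_adjoint T' S'" "column_finite S'" by (auto simp: roe_algebra_def)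
      have "norm (S - S') \<le> norm (T - T')"
        using norm_adjoint_le is_adjoint_diff[OF S(2) S'(1)] by blast
      with T'(2) S'(2) show "\<exists>S'. column_finite S' \<and> norm (S - S') < e"
        by (intro exI[of _ S']) simp
    qed
    ultimately show ?thesis unfolding roe_algebra_def using T S by blast
  qed
  then show ?thesis using closure_subset_eq by blast
qed

lemma cstar_subalgebra_roe_algebra: "cstar_subalgebra (roe_algebra :: 'a::group_add op set)"
  unfolding cstar_subalgebra_def
proof (intro conjI ballI allI)
  have "column_finite (0 :: 'a op)"
    by (rule column_finite_exact[of "{}"]) (auto simp: zero_ell2.rep_eq)
  moreover have "(0 :: 'a op) \<in> B_ell2"
    by (auto simp: B_ell2_def zero_ell2.rep_eq ell2_scaleC.rep_eq intro!: ell2_eqI)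
  moreover have "is_adjoint 0 (0 :: 'a op)"
    by (simp add: is_adjoint_def)
  ultimately show "(0 :: 'a op) \<in> roe_algebra" unfolding roe_algebra_def by blast
next
  fix S T :: "'a op" assume "S \<in> roe_algebra" "T \<in> roe_algebra"
  then obtain S' T' where *: "S \<in> B_ell2" "T \<in> B_ell2" "S' \<in> B_ell2" "T' \<in> B_ell2"
      "column_finite S" "column_finite T" "column_finite S'" "column_finite T'"
      "is_adjoint S S'" "is_adjoint T T'"
    unfolding roe_algebra_def by blast
  show "S + T \<in> roe_algebra"
    unfolding roe_algebra_def using * B_ell2_add column_finite_add is_adjoint_add by blast
  show "S o\<^sub>L T \<in> roe_algebra"
    unfolding roe_algebra_def using * B_ell2_comp column_finite_comp is_adjoint_comp by blast
next
  fix c and T :: "'a op" assume "T \<in> roe_algebra"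
  then show "op_scaleC c T \<in> roe_algebra"
    unfolding roe_algebra_def using B_ell2_op_scaleC column_finite_scaleC is_adjoint_scaleC by blast
next
  fix T :: "'a op" assume "T \<in> roe_algebra"
  then show "\<exists>S\<in>roe_algebra. is_adjoint T S"
    unfolding roe_algebra_def using is_adjoint_sym by blast
qed (auto simp: roe_algebra_def closed_roe_algebra[unfolded roe_algebra_def])

lemma mult_op_in_roe_algebra:
  assumes "bounded (range f)"
  shows "mult_op f \<in> (roe_algebra :: 'a::group_add op set)"
proof -
  have B: "mult_op f \<in> B_ell2" and C: "column_finite (mult_op f)" if "bounded (range f)" for f :: "'a \<Rightarrow> complex"
  proof -
    show "mult_op f \<in> B_ell2"
      by (auto simp: B_ell2_def mult_op_apply[OF that] ell2_scaleC.rep_eq intro!: ell2_eqI)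
    show "column_finite (mult_op f)"
      by (rule column_finite_exact[of "{0}"])
        (auto simp: mult_op_apply[OF that] basis_vec.rep_eq right_translate_def)
  qed
  have bc: "bounded (range (\<lambda>x. cnj (f x)))" using assms by (auto simp: bounded_iff)
  have "is_adjoint (mult_op f) (mult_op (\<lambda>x. cnj (f x)))"
    unfolding is_adjoint_def cinner.rep_eq
    by (simp add: mult_op_apply[OF assms] mult_op_apply[OF bc] mult_ac)
  then show ?thesis
    unfolding roe_algebra_def using B C assms bc by blast
qed

lemma lreg_in_roe_algebra: "lreg g \<in> (roe_algebra :: 'a::group_add op set)"
proof -
  have B: "lreg g \<in> B_ell2" for g :: 'a
    by (auto simp: B_ell2_def lreg_apply ell2_scaleC.rep_eq intro!: ell2_eqI)
  have C: "column_finite (lreg g)" for g :: 'a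
  proof (rule column_finite_exact[of "{g}"])
    fix y z :: 'a assume "z \<notin> right_translate {g} y"
    then have "z \<noteq> g + y" by (simp add: right_translate_def)
    then have "- g + z \<noteq> y" by auto
    then show "ell2_fun (blinfun_apply (lreg g) (basis_vec y)) z = 0"
      by (simp add: lreg_apply basis_vec.rep_eq)
  qed simp
  have bij: "bij_betw (\<lambda>h. g + h) UNIV UNIV"
    by (rule bij_betw_byWitness[where f' = "\<lambda>h. - g + h"]) auto
  have "is_adjoint (lreg g) (lreg (- g))"
    unfolding is_adjoint_def cinner.rep_eq
    by (subst infsum_reindex_bij_betw[OF bij, symmetric]) (simp add: lreg_apply)
  then show ?thesis unfolding roe_algebra_def using B C by blast
qed

lemma reduced_crossed_product_subset_roe_algebra:
  "(reduced_crossed_product :: 'a::group_add op set) \<subseteq> roe_algebra"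
  unfolding reduced_crossed_product_def
  by (rule Inter_lower) (auto simp: cstar_subalgebra_roe_algebra mult_op_in_roe_algebra lreg_in_roe_algebra)

section \<open>The representation on an orbit\<close>

definition entry :: "'a op \<Rightarrow> 'a \<Rightarrow> 'a \<Rightarrow> complex" where
  "entry T z y = ell2_fun (blinfun_apply T (basis_vec y)) z"

lemma norm_entry_le: "cmod (entry T z y) \<le> norm T"
  unfolding entry_def using norm_ell2_fun_le norm_column_le by (rule order_trans)

lemma entry_add: "entry (S + T) z y = entry S z y + entry T z y"
  by (simp add: entry_def plus_blinfun.rep_eq plus_ell2.rep_eq)

lemma entry_scaleC: "entry (op_scaleC c T) z y = c * entry T z y"
  by (simp add: entry_def op_scaleC_apply ell2_scaleC.rep_eq)

lemma entry_diff: "entry (S - T) z y = entry S z y - entry T z y"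
  by (simp add: entry_def minus_blinfun.rep_eq minus_ell2.rep_eq)

text \<open>
  Along an ultrafilter \<open>U\<close>, the entries of \<open>T\<close> at \<open>(g + x, h + x)\<close> converge to the entries of the
  image of \<open>T\<close> in the representation on the orbit of \<open>U\<close>; this is the kernel of that representation.
\<close>

definition orbit_kernel :: "'a::group_add filter \<Rightarrow> 'a op set" where
  "orbit_kernel U = {T. \<forall>g h. ((\<lambda>x. entry T (g + x) (h + x)) \<longlongrightarrow> 0) U}"

text \<open>Entries are bounded by the operator norm, so a norm approximation changes all of them by
  little simultaneously.\<close>

lemma closed_orbit_kernel: "closed (orbit_kernel U)"
proof -
  have "T \<in> orbit_kernel U" if T: "T \<in> closure (orbit_kernel U)" for T
    unfolding orbit_kernel_def
  proof (intro CollectI allI tendstoI)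
    fix g h and e :: real assume "e > 0"
    then obtain S where S: "S \<in> orbit_kernel U" "dist S T < e / 2"
      using T unfolding closure_approachable by (meson half_gt_zero)
    then have "((\<lambda>x. entry S (g + x) (h + x)) \<longlongrightarrow> 0) U" by (simp add: orbit_kernel_def)
    then have "\<forall>\<^sub>F x in U. dist (entry S (g + x) (h + x)) 0 < e / 2"
      by (rule tendstoD) (use \<open>e > 0\<close> in simp)
    then show "\<forall>\<^sub>F x in U. dist (entry T (g + x) (h + x)) 0 < e"
    proof (rule eventually_mono)
      fix x assume "dist (entry S (g + x) (h + x)) 0 < e / 2"
      moreover have "cmod (entry (S - T) (g + x) (h + x)) < e / 2"
        using norm_entry_le[of "S - T" "g + x" "h + x"] S(2) by (simp add: dist_norm)
      then have "cmod (entry T (g + x) (h + x) - entry S (g + x) (h + x)) < e / 2"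
        unfolding entry_diff by (simp add: norm_minus_commute)
      moreover have "cmod (entry T (g + x) (h + x)) \<le> cmod (entry S (g + x) (h + x))
          + cmod (entry T (g + x) (h + x) - entry S (g + x) (h + x))"
        by (rule norm_triangle_sub)
      ultimately show "dist (entry T (g + x) (h + x)) 0 < e" by simp
    qed
  qed
  then show ?thesis using closure_subset_eq by blast
qed

text \<open>The matrix product formula truncated to \<open>F + y\<close>; the error is
  \<open>S\<close> applied to the cut-off tail of a column of \<open>T\<close>. With
  column-finiteness of \<open>T\<close> it becomes small uniformly in \<open>z\<close> and
  \<open>y\<close>.\<close>

lemma entry_comp_approx:
  fixes S T :: "'a::group_add op"
  assumes "S \<in> B_ell2" "finite F"
  shows "cmod (entry (S o\<^sub>L T) z y - (\<Sum>k\<in>F. entry S z (k + y) * entry T (k + y) y)) \<le>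
    norm S * norm (blinfun_apply (cutoff (- right_translate F y)) (blinfun_apply T (basis_vec y)))"
proof -
  let ?t = "blinfun_apply T (basis_vec y)"
  let ?w = "blinfun_apply (cutoff (- right_translate F y)) ?t"
  have "?t = (\<Sum>k\<in>F. ell2_scaleC (entry T (k + y) y) (basis_vec (k + y))) + ?w"
    unfolding entry_def by (rule column_decomposition[OF assms(2)])
  then have "blinfun_apply (S o\<^sub>L T) (basis_vec y) =
      blinfun_apply S ((\<Sum>k\<in>F. ell2_scaleC (entry T (k + y) y) (basis_vec (k + y))) + ?w)"
    by simp
  also have "\<dots> = (\<Sum>k\<in>F. ell2_scaleC (entry T (k + y) y) (blinfun_apply S (basis_vec (k + y))))
      + blinfun_apply S ?w"
    by (simp only: blinfun.add_right blinfun.sum_right B_ell2_scaleC[OF assms(1)])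
  finally have "entry (S o\<^sub>L T) z y =
      (\<Sum>k\<in>F. entry T (k + y) y * entry S z (k + y)) + ell2_fun (blinfun_apply S ?w) z"
    unfolding entry_def[of "S o\<^sub>L T"]
    by (simp only: plus_ell2.rep_eq ell2_fun_sum ell2_scaleC.rep_eq entry_def[of S])
  then have "cmod (entry (S o\<^sub>L T) z y - (\<Sum>k\<in>F. entry S z (k + y) * entry T (k + y) y))
      = cmod (ell2_fun (blinfun_apply S ?w) z)"
    by (simp add: mult.commute)
  also have "\<dots> \<le> norm S * norm ?w" using norm_ell2_fun_le norm_blinfun by (rule order_trans)
  finally show ?thesis .
qed

lemma tendsto_zero_mult_bounded:
  fixes f g :: "'b \<Rightarrow> complex"
  assumes "(f \<longlongrightarrow> 0) F" "\<And>x. cmod (g x) \<le> C"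
  shows "((\<lambda>x. f x * g x) \<longlongrightarrow> 0) F"
proof (rule Lim_null_comparison)
  show "\<forall>\<^sub>F x in F. cmod (f x * g x) \<le> cmod (f x) * C"
    using assms(2) by (intro always_eventually allI) (simp add: norm_mult mult_left_mono)
  show "((\<lambda>x. cmod (f x) * C) \<longlongrightarrow> 0) F"
    using tendsto_mult[OF tendsto_norm_zero[OF assms(1)] tendsto_const[of C]] by simp
qed

text \<open>Since \<open>F\<close> does not depend on \<open>x\<close>, the truncated product is a
  sum of a fixed number of terms, in each of which one factor tends to 0 and the other is
  bounded.\<close>

lemma orbit_kernel_comp:
  fixes S T :: "'a::group_add op"
  assumes S: "S \<in> B_ell2" and T: "column_finite T" and ST: "S \<in> orbit_kernel U \<or> T \<in> orbit_kernel U"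
  shows "S o\<^sub>L T \<in> orbit_kernel U"
  unfolding orbit_kernel_def
proof (intro CollectI allI tendstoI)
  fix g h and e :: real assume e: "e > 0"
  define d where "d = e / (2 * (norm S + 1))"
  have d: "d > 0" using e norm_ge_zero[of S] by (simp add: d_def add_nonneg_pos)
  obtain F where F: "finite F"
    "\<And>y. norm (blinfun_apply (cutoff (- right_translate F y)) (blinfun_apply T (basis_vec y))) < d"
    using column_finiteE[OF T d] by blast
  \<comment> \<open>As \<open>k + (h + x) = (k + h) + x\<close>, the summation index only shifts the
    position on the orbit, so every factor is again an entry of the kind that
    \<open>orbit_kernel\<close> controls.\<close>
  let ?s = "\<lambda>x. \<Sum>k\<in>F. entry S (g + x) (k + (h + x)) * entry T (k + (h + x)) (h + x)"
  have "((\<lambda>x. entry S (g + x) (k + (h + x)) * entry T (k + (h + x)) (h + x)) \<longlongrightarrow> 0) U" for k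
    using ST
  proof
    assume "S \<in> orbit_kernel U"
    then have "((\<lambda>x. entry S (g + x) ((k + h) + x)) \<longlongrightarrow> 0) U" by (simp add: orbit_kernel_def)
    then show ?thesis
      by (intro tendsto_zero_mult_bounded[OF _ norm_entry_le]) (simp add: add.assoc)
  next
    assume "T \<in> orbit_kernel U"
    then have "((\<lambda>x. entry T ((k + h) + x) (h + x)) \<longlongrightarrow> 0) U" by (simp add: orbit_kernel_def)
    then show ?thesis
      by (subst mult.commute, intro tendsto_zero_mult_bounded[OF _ norm_entry_le]) (simp add: add.assoc)
  qed
  then have "(?s \<longlongrightarrow> 0) U" by (intro tendsto_null_sum)
  then have "\<forall>\<^sub>F x in U. dist (?s x) 0 < e / 2" using e by (intro tendstoD) auto
  then show "\<forall>\<^sub>F x in U. dist (entry (S o\<^sub>L T) (g + x) (h + x)) 0 < e"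
  proof (rule eventually_mono)
    fix x assume s: "dist (?s x) 0 < e / 2"
    have "cmod (entry (S o\<^sub>L T) (g + x) (h + x) - ?s x) \<le> norm S *
        norm (blinfun_apply (cutoff (- right_translate F (h + x))) (blinfun_apply T (basis_vec (h + x))))"
      by (rule entry_comp_approx[OF S F(1)])
    also have "\<dots> \<le> norm S * d" using F(2)[of "h + x"] by (intro mult_left_mono) auto
    also have "\<dots> < (norm S + 1) * d" using d by (simp add: algebra_simps)
    also have "\<dots> = e / 2"
      using norm_ge_zero[of S] by (simp add: d_def field_simps add_nonneg_eq_0_iff)
    finally have "cmod (entry (S o\<^sub>L T) (g + x) (h + x) - ?s x) < e / 2" .
    moreover have "cmod (entry (S o\<^sub>L T) (g + x) (h + x)) \<le>
        cmod (?s x) + cmod (entry (S o\<^sub>L T) (g + x) (h + x) - ?s x)"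
      by (rule norm_triangle_sub)
    ultimately show "dist (entry (S o\<^sub>L T) (g + x) (h + x)) 0 < e" using s by simp
  qed
qed

text \<open>Compactness of a closed disc gives a cluster point, and a cluster point of an
  ultrafilter is a limit because each neighbourhood or its complement is a member.\<close>

lemma ultrafilter_convergent:
  fixes f :: "'b \<Rightarrow> complex"
  assumes "ultrafilter U" "\<And>x. cmod (f x) \<le> C"
  shows "\<exists>l. (f \<longlongrightarrow> l) U"
proof -
  have "compact (cball (0 :: complex) C)" by simp
  moreover have "filtermap f U \<noteq> bot"
    using assms(1) by (simp add: ultrafilter_def filtermap_bot_iff)
  moreover have "\<forall>\<^sub>F z in filtermap f U. z \<in> cball 0 C"
    using assms(2) by (simp add: eventually_filtermap)
  ultimately obtain l where l: "inf (nhds l) (filtermap f U) \<noteq> bot"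
    unfolding compact_filter by blast
  have "(f \<longlongrightarrow> l) U"
  proof (rule topological_tendstoI)
    fix W assume W: "open W" "l \<in> W"
    show "\<forall>\<^sub>F x in U. f x \<in> W"
    proof (rule ccontr)
      assume "\<not> (\<forall>\<^sub>F x in U. f x \<in> W)"
      then have "\<forall>\<^sub>F z in filtermap f U. z \<notin> W"
        using assms(1) by (auto simp: ultrafilter_def eventually_filtermap)
      moreover have "\<forall>\<^sub>F z in nhds l. z \<in> W" using W by (rule eventually_nhds_in_open)
      ultimately have "\<forall>\<^sub>F z in inf (nhds l) (filtermap f U). False"
        unfolding eventually_inf by blast
      with l show False by (simp add: trivial_limit_def)
    qed
  qed
  then show ?thesis ..
qed

text \<open>The joint kernel of finitely many functionals has finite codimension: each new
  functional costs at most one more spanning vector. Linearity is available on \<open>C\<close>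
  only, so all vectors used have to stay in \<open>C\<close>.\<close>

lemma (in vector_space) finite_codimension_spanning:
  assumes "finite J" "subspace C"
    and add: "\<And>i x y. i \<in> J \<Longrightarrow> x \<in> C \<Longrightarrow> y \<in> C \<Longrightarrow> \<phi> i (x + y) = \<phi> i x + \<phi> i y"
    and scale: "\<And>i c x. i \<in> J \<Longrightarrow> x \<in> C \<Longrightarrow> \<phi> i (scale c x) = c * \<phi> i x"
  shows "\<exists>B. finite B \<and> B \<subseteq> C \<and> (\<forall>x\<in>C. \<exists>b\<in>span B. \<forall>i\<in>J. \<phi> i (x - b) = (0 :: 'a))"
  using assms(1,3,4)
proof (induction J)
  case empty
  then show ?case by (intro exI[of _ "{}"]) (auto intro: span_zero)
next
  case (insert j J)
  have "\<exists>B. finite B \<and> B \<subseteq> C \<and> (\<forall>x\<in>C. \<exists>b\<in>span B. \<forall>i\<in>J. \<phi> i (x - b) = 0)"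
    by (rule insert.IH) (simp_all add: insert.prems)
  then obtain B where B: "finite B" "B \<subseteq> C" "\<forall>x\<in>C. \<exists>b\<in>span B. \<forall>i\<in>J. \<phi> i (x - b) = 0"
    by auto
  have spanC: "span B \<subseteq> C" using B(2) assms(2) by (rule span_minimal)
  show ?case
  proof (cases "\<exists>x0\<in>C. (\<forall>i\<in>J. \<phi> i x0 = 0) \<and> \<phi> j x0 \<noteq> 0")
    case True
    then obtain x0 where x0: "x0 \<in> C" "\<And>i. i \<in> J \<Longrightarrow> \<phi> i x0 = 0" "\<phi> j x0 \<noteq> 0" by auto
    have "\<exists>b\<in>span (insert x0 B). \<forall>i\<in>insert j J. \<phi> i (x - b) = 0" if x: "x \<in> C" for x
    proof -
      obtain b where b: "b \<in> span B" "\<And>i. i \<in> J \<Longrightarrow> \<phi> i (x - b) = 0" using B(3) x by auto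
      \<comment> \<open>This multiple of \<open>x0\<close> cancels the value at \<open>j\<close>,
        and the values at \<open>J\<close> are untouched since they vanish on
        \<open>x0\<close>.\<close>
      define c where "c = \<phi> j (x - b) / \<phi> j x0"
      have xb: "x - b \<in> C" using x b(1) spanC assms(2) by (auto intro: subspace_diff)
      have "\<phi> i (x - (b + scale c x0)) = \<phi> i (x - b) - c * \<phi> i x0" if "i \<in> insert j J" for i
      proof -
        have "\<phi> i (x - (b + scale c x0)) = \<phi> i ((x - b) + scale (- c) x0)"
          by (simp add: algebra_simps)
        also have "\<dots> = \<phi> i (x - b) + \<phi> i (scale (- c) x0)"
          using that xb x0(1) assms(2) by (intro insert.prems) (auto intro: subspace_scale subspace_neg)
        also have "\<dots> = \<phi> i (x - b) - c * \<phi> i x0"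
          using insert.prems(2)[OF that x0(1), of "- c"] by simp
        finally show ?thesis .
      qed
      then have "\<forall>i\<in>insert j J. \<phi> i (x - (b + scale c x0)) = 0"
        using b(2) x0(2,3) by (auto simp: c_def)
      moreover have "b + scale c x0 \<in> span (insert x0 B)"
      proof (rule span_add)
        show "b \<in> span (insert x0 B)" using b(1) span_mono[of B "insert x0 B"] by blast
        show "scale c x0 \<in> span (insert x0 B)" by (intro span_scale span_base) simp
      qed
      ultimately show ?thesis by blast
    qed
    then show ?thesis using B(1,2) x0(1) by (intro exI[of _ "insert x0 B"]) auto
  next
    case False
    \<comment> \<open>Here the functional at \<open>j\<close> already vanishes wherever those at
      \<open>J\<close> do, so the old \<open>b\<close> serves.\<close>
    have "\<exists>b\<in>span B. \<forall>i\<in>insert j J. \<phi> i (x - b) = 0" if x: "x \<in> C" for x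
    proof -
      obtain b where b: "b \<in> span B" "\<forall>i\<in>J. \<phi> i (x - b) = 0" using B(3) x by auto
      moreover have "x - b \<in> C" using x b(1) spanC assms(2) by (auto intro: subspace_diff)
      ultimately show ?thesis using False by auto
    qed
    then show ?thesis using B(1,2) by (intro exI[of _ B]) auto
  qed
qed

section \<open>The corner in the orbit representation\<close>

lemma corner_subset_roe_algebra: "corner A \<subseteq> roe_algebra"
  using reduced_crossed_product_subset_roe_algebra by (auto simp: in_corner_iff)

lemma corner_0: "0 \<in> corner A"
    and corner_add: "S \<in> corner A \<Longrightarrow> T \<in> corner A \<Longrightarrow> S + T \<in> corner A"
    and corner_scaleC: "T \<in> corner A \<Longrightarrow> op_scaleC c T \<in> corner A"
    and corner_comp: "S \<in> corner A \<Longrightarrow> T \<in> corner A \<Longrightarrow> S o\<^sub>L T \<in> corner A"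
proof -
  show "0 \<in> corner A"
    by (simp add: in_corner_iff reduced_crossed_product_intros)
  show "S + T \<in> corner A" if "S \<in> corner A" "T \<in> corner A"
  proof -
    have "cutoff A o\<^sub>L (S + T) o\<^sub>L cutoff A = (cutoff A o\<^sub>L S o\<^sub>L cutoff A) + (cutoff A o\<^sub>L T o\<^sub>L cutoff A)"
      by (rule blinfun_eqI) (simp add: plus_blinfun.rep_eq blinfun.add_right)
    then show ?thesis using that by (simp add: in_corner_iff reduced_crossed_product_intros)
  qed
  show "op_scaleC c T \<in> corner A" if "T \<in> corner A"
  proof -
    have "cutoff A o\<^sub>L op_scaleC c T o\<^sub>L cutoff A = op_scaleC c (cutoff A o\<^sub>L T o\<^sub>L cutoff A)"
      by (rule blinfun_eqI) (simp add: op_scaleC_apply ell2_scaleC_cutoff)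
    then show ?thesis using that by (simp add: in_corner_iff reduced_crossed_product_intros)
  qed
  show "S o\<^sub>L T \<in> corner A" if "S \<in> corner A" "T \<in> corner A"
  proof -
    have "cutoff A o\<^sub>L (S o\<^sub>L T) o\<^sub>L cutoff A = (cutoff A o\<^sub>L S) o\<^sub>L (T o\<^sub>L cutoff A)" by (simp add: op_comp_assoc)
    also have "\<dots> = S o\<^sub>L T" by (simp only: cutoff_comp_corner[OF that(1)] corner_comp_cutoff[OF that(2)])
    finally show ?thesis using that by (simp add: in_corner_iff reduced_crossed_product_intros)
  qed
qed

lemma entry_corner:
  assumes "T \<in> corner A" "z \<notin> A \<or> y \<notin> A"
  shows "entry T z y = 0"
proof -
  have "entry T z y = ell2_fun (blinfun_apply (cutoff A o\<^sub>L T o\<^sub>L cutoff A) (basis_vec y)) z"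
    using assms(1) by (simp add: in_corner_iff entry_def)
  also have "\<dots> = 0"
  proof (cases "z \<in> A")
    case True
    then have "blinfun_apply (cutoff A) (basis_vec y) = 0"
      using assms(2) by (intro ell2_eqI) (auto simp: cutoff_apply basis_vec.rep_eq zero_ell2.rep_eq)
    then show ?thesis by (simp add: zero_ell2.rep_eq)
  qed (simp add: cutoff_apply)
  finally show ?thesis .
qed

text \<open>Absorption on both sides is \<open>orbit_kernel_comp\<close>, whose hypotheses hold on
  the corner because it lies in the Roe algebra.\<close>

lemma closed_ideal_orbit_kernel: "closed_ideal (corner A) (corner A \<inter> orbit_kernel U)"
proof -
  have roe: "S \<in> B_ell2" "column_finite S" if "S \<in> corner A" for S :: "'a op"
    using that corner_subset_roe_algebra[of A] by (auto simp: roe_algebra_def)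
  have "closedin (top_of_set (corner A)) (corner A \<inter> orbit_kernel U)"
    using closed_orbit_kernel by (rule closedin_closed_Int)
  moreover have "0 \<in> orbit_kernel U"
    by (simp add: orbit_kernel_def entry_def zero_ell2.rep_eq)
  moreover have "S + T \<in> orbit_kernel U" if "S \<in> orbit_kernel U" "T \<in> orbit_kernel U" for S T
    using that by (auto simp: orbit_kernel_def entry_add intro: tendsto_add_zero)
  moreover have "op_scaleC c T \<in> orbit_kernel U" if "T \<in> orbit_kernel U" for c T
    using that by (auto simp: orbit_kernel_def entry_scaleC intro: tendsto_mult_right_zero)
  moreover have "S o\<^sub>L T \<in> orbit_kernel U"
    if "S \<in> corner A" "T \<in> corner A" "S \<in> orbit_kernel U \<or> T \<in> orbit_kernel U" for S T
    using orbit_kernel_comp[OF roe(1)[OF that(1)] roe(2)[OF that(2)] that(3)] .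
  ultimately show ?thesis
    unfolding closed_ideal_def
    by (intro conjI ballI allI) (auto intro: corner_0 corner_add corner_scaleC corner_comp)
qed

text \<open>Elements of the corner have no entries outside \<open>A \<times> A\<close>, so only
  limit entries indexed by pairs of returns can be non-zero. These finitely many functionals have
  exactly the ideal as common kernel on the corner.\<close>

lemma findim_quotient_of_finite_returns:
  fixes A :: "'a::group_add set"
  assumes U: "ultrafilter U" and UA: "\<forall>\<^sub>F x in U. x \<in> A"
    and fin: "finite {g. \<forall>\<^sub>F x in U. g + x \<in> A}"
  shows "has_nonzero_findim_quotient (corner A)"
proof -
  interpret vs: vector_space "op_scaleC :: complex \<Rightarrow> 'a op \<Rightarrow> 'a op"
    by (rule vector_space_op_scaleC)
  let ?C = "corner A" and ?R = "{g. \<forall>\<^sub>F x in U. g + x \<in> A}"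
  define I where "I = ?C \<inter> orbit_kernel U"
  have I: "closed_ideal ?C I" unfolding I_def by (rule closed_ideal_orbit_kernel)
  have bot: "U \<noteq> bot" using U by (simp add: ultrafilter_def)
  have "quotient ?C I \<noteq> {I}"
  proof
    assume "quotient ?C I = {I}"
    then have "coset I (cutoff A) = I"
      unfolding quotient_def using cutoff_in_corner[of A A] by blast
    moreover have "cutoff A + 0 \<in> coset I (cutoff A)"
      unfolding coset_def using closed_ideal_0[OF I] by (rule imageI)
    ultimately have "cutoff A \<in> orbit_kernel U" by (simp add: I_def)
    \<comment> \<open>The diagonal entry at \<open>g = h = 0\<close> distinguishes
      \<open>cutoff A\<close> from 0, because \<open>A\<close> is a member of
      \<open>U\<close>.\<close>
    then have "((\<lambda>x. entry (cutoff A) (0 + x) (0 + x)) \<longlongrightarrow> 0) U" unfolding orbit_kernel_def by blast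
    then have "((\<lambda>x. entry (cutoff A) x x) \<longlongrightarrow> 0) U" by simp
    moreover have "\<forall>\<^sub>F x in U. entry (cutoff A) x x = 1"
      using UA by (rule eventually_mono) (simp add: entry_def cutoff_apply basis_vec.rep_eq)
    then have "((\<lambda>x. entry (cutoff A) x x) \<longlongrightarrow> 1) U" by (rule tendsto_eventually)
    ultimately show False using tendsto_unique[OF bot] zero_neq_one by blast
  qed
  moreover have "\<exists>B. finite B \<and> B \<subseteq> ?C \<and> quotient ?C I = coset I ` vs.span B"
  proof -
    \<comment> \<open>The matrix entries of the image of \<open>T\<close> on the orbit; the limits
      exist because entries are bounded by \<open>norm T\<close>.\<close>
    define \<phi> where "\<phi> p T = Lim U (\<lambda>x. entry T (fst p + x) (snd p + x))" for p :: "'a \<times> 'a" and T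
    have lim: "((\<lambda>x. entry T (g + x) (h + x)) \<longlongrightarrow> \<phi> (g, h) T) U" for g h T
    proof -
      obtain l where l: "((\<lambda>x. entry T (g + x) (h + x)) \<longlongrightarrow> l) U"
        using ultrafilter_convergent[OF U, of "\<lambda>x. entry T (g + x) (h + x)", OF norm_entry_le] by blast
      then have "\<phi> (g, h) T = l" unfolding \<phi>_def using bot by (simp add: tendsto_Lim)
      with l show ?thesis by simp
    qed
    have sub: "vs.subspace ?C"
      unfolding vs.subspace_def using corner_0 corner_add corner_scaleC by blast
    have "\<phi> p (S + T) = \<phi> p S + \<phi> p T" for p S T
      using tendsto_unique[OF bot lim[of "S + T" "fst p" "snd p"]]
        tendsto_add[OF lim[of S "fst p" "snd p"] lim[of T "fst p" "snd p"]]
      by (simp add: entry_add)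
    moreover have "\<phi> p (op_scaleC c T) = c * \<phi> p T" for p c T
      using tendsto_unique[OF bot lim[of "op_scaleC c T" "fst p" "snd p"]]
        tendsto_mult[OF tendsto_const[of c] lim[of T "fst p" "snd p"]]
      by (simp add: entry_scaleC)
    ultimately obtain B where B: "finite B" "B \<subseteq> ?C"
        "\<forall>T\<in>?C. \<exists>b\<in>vs.span B. \<forall>p\<in>?R \<times> ?R. \<phi> p (T - b) = 0"
      using vs.finite_codimension_spanning[of "?R \<times> ?R" ?C \<phi>] fin sub by auto
    have span: "vs.span B \<subseteq> ?C" using B(2) sub by (rule vs.span_minimal)
    have mem: "T \<in> orbit_kernel U" if T: "T \<in> ?C" "\<forall>p\<in>?R \<times> ?R. \<phi> p T = 0" for T
      unfolding orbit_kernel_def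
    proof (intro CollectI allI)
      fix g h
      show "((\<lambda>x. entry T (g + x) (h + x)) \<longlongrightarrow> 0) U"
      proof (cases "(g, h) \<in> ?R \<times> ?R")
        case True
        then show ?thesis using lim[where g = g and h = h and T = T] T(2) by auto
      next
        \<comment> \<open>One of \<open>g\<close>, \<open>h\<close> is not a return, so for
          \<open>U\<close>-almost all \<open>x\<close> one of \<open>g + x\<close>,
          \<open>h + x\<close> lies outside \<open>A\<close>.\<close>
        case False
        then have "\<forall>\<^sub>F x in U. \<not> (g + x \<in> A \<and> h + x \<in> A)"
          by (simp add: ultrafilter_not_iff[OF U] eventually_conj_iff del: de_Morgan_conj)
        then have "\<forall>\<^sub>F x in U. entry T (g + x) (h + x) = 0"
          by (rule eventually_mono) (use entry_corner[OF T(1)] in blast)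
        then show ?thesis by (rule tendsto_eventually)
      qed
    qed
    have "coset I T \<in> coset I ` vs.span B" if T: "T \<in> ?C" for T
    proof -
      obtain b where b: "b \<in> vs.span B" "\<forall>p\<in>?R \<times> ?R. \<phi> p (T - b) = 0" using B(3) T by blast
      have "T - b \<in> ?C" using T b(1) span sub by (auto intro: vs.subspace_diff)
      then have TI: "T - b \<in> I" using mem b(2) by (simp add: I_def)
      then have "coset I T = coset I b" by (rule coset_eqI[OF I])
      then show ?thesis using b(1) by blast
    qed
    then have "quotient ?C I = coset I ` vs.span B"
      unfolding quotient_def using span by blast
    then show ?thesis using B(1,2) by blast
  qed
  ultimately show ?thesis
    unfolding has_nonzero_findim_quotient_def using I by blast
qed

theorem theorem7p10:
  fixes A :: "'a::group_add set"
  assumes "A \<noteq> {}"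
  shows "((\<exists>M. minimal_closed_invariant A M \<and> subtopology (X_top A) M = discrete_topology M)
           \<longleftrightarrow> has_nonzero_findim_quotient (corner A))
       \<and> (has_nonzero_findim_quotient (corner A) \<longleftrightarrow> \<not> infinitely_divisible A)"
proof -
  \<comment> \<open>Conditions (i) and (ii) each imply (iii) on their own, and (iii) produces one
    ultrafilter that serves for both converses.\<close>
  have "\<not> infinitely_divisible A"
    if "minimal_closed_invariant A M" "subtopology (X_top A) M = discrete_topology M" for M
    using that not_infinitely_divisible_of_discrete[of M A] by (simp add: minimal_closed_invariant_def)
  moreover have "\<exists>U. ultrafilter U \<and> (\<forall>\<^sub>F x in U. x \<in> A) \<and> finite {g. \<forall>\<^sub>F x in U. g + x \<in> A}"
    if "\<not> infinitely_divisible A"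
    using that finite_returns_of_not_divisible[OF assms] by (auto simp: infinitely_divisible_def)
  ultimately show ?thesis
    using discrete_minimal_of_finite_returns[of _ A] findim_quotient_of_finite_returns[of _ A]
      not_infinitely_divisible_of_findim_quotient[OF assms] by blast
qed

end
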